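(* (Completeness Theorem 2) Consider $\mathfrak M$-valued logic over a finite De Morgan algebra $\mathfrak M$ with universe $M$, and let $Q\subseteq M$. Let $\Sigma$ be a set of formulas and $\phi$ a formula. (a) If $\Sigma\models\phi$, then $\Sigma\vdash\phi$. (b) If $\Sigma\models_Q\phi$, then $\Sigma\vdash_Q\phi$.
   Context: **De Morgan algebra.** $\mathfrak M=\langle M,+,\cdot,-,0,1\rangle$ is a finite De Morgan algebra with $0\neq 1$: $+$ and $\cdot$ are commutative, associative, each distributes over the other, $x+0=x$, $x\cdot 1=x$, $x\cdot(x+y)=x=x+(x\cdot y)$, $-(x+y)=-x\cdot -y$, $-(x\cdot y)=-x+-y$, $--x=x$. $x\le y$ iff $x\cdot y=x$. Whenever $\sup A$ is written, $A$ ranges over nonempty subsets of $M$, and $\sup A$ is the $+$-sum of its elements. **Syntax.** Symbols: variables $v_k$ ($k\in\omega$), $n_i$-ary relation symbols $R_i$ ($i\in I$, $I\ne\emptyset$), $\approx$, $\neg$, $\wedge$, $\vee$, $\exists$, and $\gamma_p$, $t_p$ for $p\in M$. Formulas: $R_iv_{k_0}\cdots v_{k_{n_i-1}}$, $v_j\approx v_k$, $t_p$ are formulas; if $\phi,\theta$ are formulas so are $\neg\phi$, $(\phi\wedge\theta)$, $(\phi\vee\theta)$, $\exists v_k\phi$, $\gamma_p\phi$. $Fv(\phi)$ is the set of indices of free variables: $Fv(t_p)=\emptyset$, $Fv(v_i\approx v_j)=\{i,j\}$, $Fv(R_iv_{k_0}\cdots v_{k_{n_i-1}})=\{k_0,\dots,k_{n_i-1}\}$,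 $Fv(\neg\phi)=Fv(\gamma_p\phi)=Fv(\phi)$, $Fv(\phi\wedge\theta)=Fv(\phi\vee\theta)=Fv(\phi)\cup Fv(\theta)$, $Fv(\exists v_k\phi)=Fv(\phi)\setminus\{k\}$. Abbreviations ($\bigvee,\bigwedge$ over finite index sets are iterated $\vee,\wedge$ in some fixed order and bracketing; an empty $\bigvee$ is $t_0$): $\theta\rightarrow\phi$ is $\neg\theta\vee\phi$; $\theta\Rightarrow\phi$ is $\bigwedge_{r\in M}(\gamma_r\phi\rightarrow\bigvee_{q\le r}\gamma_q\theta)$; $\theta\Leftrightarrow\phi$ is $(\theta\Rightarrow\phi)\wedge(\phi\Rightarrow\theta)$; $\forall v_k\phi$ is $\neg\exists v_k\neg\phi$; $\Gamma\phi$ is $\gamma_0\phi\vee\gamma_1\phi$; $S^k_l\phi$ is $\exists v_k(v_k\approx v_l\wedge\phi)$. For $Q\subseteq M$, $\phi^Q$ is $\bigvee_{p\in Q}\gamma_p\phi$ and $\Sigma^Q=\{\phi^Q:\phi\in\Sigma\}$. **Semantics.** An $\mathfrak M$-structure is $\mathfrak A=\langle U,P_i\rangle_{i\in I}$ with $U\ne\emptyset$ and each $P_i:M\to\mathcal P(U^{n_i})$ such that the sets $P_i^q$ ($q\in M$) are pairwise disjoint with union $U^{n_i}$. Each formula $\phi$ gets $\phi^{\mathfrak A}:M\to\mathcal P(U^\omega)$, with $q$-component $(\phi^{\mathfrak A})^q$: $((R_iv_{k_0}\cdots v_{k_{n_i-1}})^{\mathfrak A})^q=\{s:(s_{k_0},\dots,s_{k_{n_i-1}})\in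 P_i^q\}$; $((v_j\approx v_k)^{\mathfrak A})^p$ is $\{s:s_j=s_k\}$ if $p=1$, its complement if $p=0$, $\emptyset$ otherwise; $(t_p^{\mathfrak A})^q=U^\omega$ if $q=p$, else $\emptyset$; $((\phi\vee\theta)^{\mathfrak A})^p=\bigcup_{q+r=p}(\phi^{\mathfrak A})^q\cap(\theta^{\mathfrak A})^r$; $((\phi\wedge\theta)^{\mathfrak A})^p=\bigcup_{q\cdot r=p}(\phi^{\mathfrak A})^q\cap(\theta^{\mathfrak A})^r$; $((\neg\phi)^{\mathfrak A})^p=(\phi^{\mathfrak A})^{-p}$; $((\exists v_k\phi)^{\mathfrak A})^p=\bigcup_{\sup A=p}\bigcap_{q\in A}C_k(\phi^{\mathfrak A})^q\setminus\bigcup_{\sup A>p}\bigcap_{q\in A}C_k(\phi^{\mathfrak A})^q$, where $C_kX=\{s\in U^\omega:$ changing the $k$-th entry of $s$ to some $x\in U$ gives a member of $X\}$; $((\gamma_p\phi)^{\mathfrak A})^q$ is $(\phi^{\mathfrak A})^p$ if $q=1$, its complement if $q=0$, $\emptyset$ otherwise. $\phi$ is true in $\mathfrak A$ if $(\phi^{\mathfrak A})^1=U^\omega$; $\phi$ is $Q$-true in $\mathfrak A$ if $\bigcup_{p\in Q}(\phi^{\mathfrak A})^p=U^\omega$. $\mathfrak A$ is a model (resp. $Q$-model) of $\Sigma$ if every $\phi\in\Sigma$ is true (resp. $Q$-true) in $\mathfrak A$. $\Sigma\models\phi$ if $\phi$ is true in every model of $\Sigma$; $\Sigma\models_Q\phi$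 if $\phi$ is $Q$-true in every $Q$-model of $\Sigma$. **Tautologies.** Prime formulas are those of the forms $\exists v_k\phi$, $v_j\approx v_k$, $R_iv_{k_0}\cdots v_{k_{n_i-1}}$; $\mathbb P$ is the set of them. For $v:\mathbb P\to M$ define $T(\phi,v)\in M$: $T(\phi,v)=v(\phi)$ for $\phi\in\mathbb P$; $T(\phi\vee\theta,v)=T(\phi,v)+T(\theta,v)$; $T(\phi\wedge\theta,v)=T(\phi,v)\cdot T(\theta,v)$; $T(\neg\phi,v)=-T(\phi,v)$; $T(t_p,v)=p$; $T(\gamma_p\phi,v)=1$ if $T(\phi,v)=p$, else $0$. $\phi$ is a tautology if $T(\phi,v)=1$ for all $v$. **Proof system.** Axioms: all tautologies, and all formulas of the following forms: 1. $\Gamma\forall v_k\phi\rightarrow(\forall v_k\phi\rightarrow\phi)$; 2. $\gamma_1\exists v_k\gamma_1\phi\Leftrightarrow\exists v_k\gamma_1\phi$; 3. $\gamma_1(v_k\approx v_l)\Leftrightarrow v_k\approx v_l$; 4. $\gamma_p(v_k\approx v_l)\Leftrightarrow t_0$ if $p\notin\{0,1\}$; 5. $\gamma_0(v_k\approx v_l)\Leftrightarrow\neg v_k\approx v_l$; 6. $\exists v_kt_0\Leftrightarrow t_0$; 7. $\phi\vee\exists v_k\phi\Leftrightarrow\exists v_k\phi$; 8. $\exists v_k(\phi\wedge\exists v_k\theta)\Leftrightarrow\exists v_k\phi\wedge\exists v_k\theta$; 9. $\exists v_k\exists v_l\phi\Leftrightarrow\exists v_l\exists v_k\phi$; 10.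 $v_k\approx v_k\Leftrightarrow t_1$; 11. $v_l\approx v_m\Leftrightarrow\exists v_k(v_l\approx v_k\wedge v_k\approx v_m)$ if $k\notin\{l,m\}$; 12. $\exists v_k(v_k\approx v_l\wedge\gamma_1\phi)\wedge\exists v_k(v_k\approx v_l\wedge\neg\gamma_1\phi)\Leftrightarrow t_0$ if $k\neq l$; 13. $\gamma_p(\exists v_k\phi)\Leftrightarrow\big(\bigvee_{\sup A=p}\bigwedge_{q\in A}\exists v_k\gamma_q\phi\big)\wedge\neg\big(\bigvee_{\sup A>p}\bigwedge_{q\in A}\exists v_k\gamma_q\phi\big)$; 14. $R_iv_{j_0}\cdots v_{j_{n_i-1}}\Leftrightarrow S^{k_0}_{j_0}\cdots S^{k_{n_i-1}}_{j_{n_i-1}}S^0_{k_0}\cdots S^{n_i-1}_{k_{n_i-1}}R_iv_0\cdots v_{n_i-1}$ where the $k_m$ are distinct and $k_m\notin\{0,\dots,n_i-1,j_0,\dots,j_{n_i-1}\}$ for $m<n_i$. Rules: (Modus Ponens) from $\phi$ and $\phi\rightarrow\theta$ infer $\theta$; ($\Gamma$-rule) from $\phi$ infer $\Gamma\phi$; ($\exists$-rule) from $\theta\Rightarrow\phi$ infer $\exists v_k\theta\Rightarrow\phi$ if $k\notin Fv(\phi)$. $\Sigma\vdash\phi$ means there is a finite sequence of formulas ending in $\phi$, each of which is in $\Sigma$, is an axiom, or follows from earlier ones by a rule. $\Sigma\vdash_Q\phi$ means $\Sigma^Q\vdash\phi^Q$. *)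

theory Defs
  imports Main
begin

section \<open>De Morgan algebras\<close>

text \<open>
  The operations \<open>+\<close>, \<open>\<cdot>\<close>, \<open>-\<close>, \<open>0\<close>, \<open>1\<close> of the algebra are written \<open>sup\<close>, \<open>inf\<close>, \<open>uminus\<close>,
  \<open>bot\<close>, \<open>top\<close>; the equations for the first two and for \<open>0\<close>, \<open>1\<close> are those of a bounded
  distributive lattice, whose order is \<open>x \<le> y \<longleftrightarrow> inf x y = x\<close>.  The universe \<open>M\<close> is a whole
  type, and its finiteness is the sort \<open>finite\<close>.
\<close>

class de_morgan_algebra = distrib_lattice + bounded_lattice + uminus +
  assumes uminus_sup: "- (sup x y) = inf (- x) (- y)"
    and uminus_inf: "- (inf x y) = sup (- x) (- y)"
    and uminus_uminus: "- (- x) = x"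
    and bot_neq_top: "bot \<noteq> top"

instance bool :: de_morgan_algebra
  by standard auto


section \<open>Syntax\<close>

text \<open>
  The index set \<open>I\<close> of the relation symbols is the type \<^typ>\<open>'i\<close>.  Arities are not part of the
  datatype: given \<open>ar :: 'i \<Rightarrow> nat\<close>, the formulas of the language are the members of
  \<open>formulas ar\<close> below.
\<close>

datatype ('i, 'm) fm =
    Rel 'i "nat list"
  | Eql nat nat
  | Tv 'm
  | Neg "('i, 'm) fm"
  | Conj "('i, 'm) fm" "('i, 'm) fm"
  | Disj "('i, 'm) fm" "('i, 'm) fm"
  | Exists nat "('i, 'm) fm"
  | Gam 'm "('i, 'm) fm"

primrec wf_fm :: "('i \<Rightarrow> nat) \<Rightarrow> ('i, 'm) fm \<Rightarrow> bool" where
  "wf_fm ar (Rel i ks) \<longleftrightarrow> length ks = ar i"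
| "wf_fm ar (Eql j k) \<longleftrightarrow> True"
| "wf_fm ar (Tv p) \<longleftrightarrow> True"
| "wf_fm ar (Neg \<phi>) \<longleftrightarrow> wf_fm ar \<phi>"
| "wf_fm ar (Conj \<phi> \<theta>) \<longleftrightarrow> wf_fm ar \<phi> \<and> wf_fm ar \<theta>"
| "wf_fm ar (Disj \<phi> \<theta>) \<longleftrightarrow> wf_fm ar \<phi> \<and> wf_fm ar \<theta>"
| "wf_fm ar (Exists k \<phi>) \<longleftrightarrow> wf_fm ar \<phi>"
| "wf_fm ar (Gam p \<phi>) \<longleftrightarrow> wf_fm ar \<phi>"

definition formulas :: "('i \<Rightarrow> nat) \<Rightarrow> ('i, 'm) fm set" where
  "formulas ar = {\<phi>. wf_fm ar \<phi>}"

primrec Fv :: "('i, 'm) fm \<Rightarrow> nat set" where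
  "Fv (Rel i ks) = set ks"
| "Fv (Eql j k) = {j, k}"
| "Fv (Tv p) = {}"
| "Fv (Neg \<phi>) = Fv \<phi>"
| "Fv (Conj \<phi> \<theta>) = Fv \<phi> \<union> Fv \<theta>"
| "Fv (Disj \<phi> \<theta>) = Fv \<phi> \<union> Fv \<theta>"
| "Fv (Exists k \<phi>) = Fv \<phi> - {k}"
| "Fv (Gam p \<phi>) = Fv \<phi>"

text \<open>Iterated disjunction and conjunction over a finite index set, in an arbitrary but fixed
  order chosen by Hilbert's operator, bracketed to the right.\<close>

definition enum_set :: "'a set \<Rightarrow> 'a list" where
  "enum_set A = (SOME xs. set xs = A \<and> distinct xs)"

fun disj_list :: "('i, 'm::de_morgan_algebra) fm list \<Rightarrow> ('i, 'm) fm" where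
  "disj_list [] = Tv bot"
| "disj_list [\<phi>] = \<phi>"
| "disj_list (\<phi> # \<psi> # \<phi>s) = Disj \<phi> (disj_list (\<psi> # \<phi>s))"

fun conj_list :: "('i, 'm::de_morgan_algebra) fm list \<Rightarrow> ('i, 'm) fm" where
  "conj_list [] = Tv top"  \<comment> \<open>never used: all conjunctions below have a nonempty index set\<close>
| "conj_list [\<phi>] = \<phi>"
| "conj_list (\<phi> # \<psi> # \<phi>s) = Conj \<phi> (conj_list (\<psi> # \<phi>s))"

definition BigDisj :: "'a set \<Rightarrow> ('a \<Rightarrow> ('i, 'm::de_morgan_algebra) fm) \<Rightarrow> ('i, 'm) fm" where
  "BigDisj A f = disj_list (map f (enum_set A))"

definition BigConj :: "'a set \<Rightarrow> ('a \<Rightarrow> ('i, 'm::de_morgan_algebra) fm) \<Rightarrow> ('i, 'm) fm" where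
  "BigConj A f = conj_list (map f (enum_set A))"

text \<open>The arrows below are, in order, the connectives \<open>\<rightarrow>\<close>, \<open>\<Rightarrow>\<close> and \<open>\<Leftrightarrow>\<close> of the logic.\<close>

definition Imp :: "('i, 'm) fm \<Rightarrow> ('i, 'm) fm \<Rightarrow> ('i, 'm) fm"  (infixr "\<^bold>\<rightarrow>" 55) where
  "\<theta> \<^bold>\<rightarrow> \<phi> = Disj (Neg \<theta>) \<phi>"

definition Leq :: "('i, 'm::{finite,de_morgan_algebra}) fm \<Rightarrow> ('i, 'm) fm \<Rightarrow> ('i, 'm) fm"
    (infixr "\<^bold>\<Rightarrow>" 55) where
  "\<theta> \<^bold>\<Rightarrow> \<phi> = BigConj UNIV (\<lambda>r. Gam r \<phi> \<^bold>\<rightarrow> BigDisj {q. q \<le> r} (\<lambda>q. Gam q \<theta>))"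

definition Equiv :: "('i, 'm::{finite,de_morgan_algebra}) fm \<Rightarrow> ('i, 'm) fm \<Rightarrow> ('i, 'm) fm"
    (infixr "\<^bold>\<Leftrightarrow>" 55) where
  "\<theta> \<^bold>\<Leftrightarrow> \<phi> = Conj (\<theta> \<^bold>\<Rightarrow> \<phi>) (\<phi> \<^bold>\<Rightarrow> \<theta>)"

definition Forall :: "nat \<Rightarrow> ('i, 'm) fm \<Rightarrow> ('i, 'm) fm" where
  "Forall k \<phi> = Neg (Exists k (Neg \<phi>))"

definition GGam :: "('i, 'm::de_morgan_algebra) fm \<Rightarrow> ('i, 'm) fm" where
  "GGam \<phi> = Disj (Gam bot \<phi>) (Gam top \<phi>)"

definition Sub :: "nat \<Rightarrow> nat \<Rightarrow> ('i, 'm) fm \<Rightarrow> ('i, 'm) fm" where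
  "Sub k l \<phi> = Exists k (Conj (Eql k l) \<phi>)"

definition Qfm :: "'m set \<Rightarrow> ('i, 'm::{finite,de_morgan_algebra}) fm \<Rightarrow> ('i, 'm) fm" where
  "Qfm Q \<phi> = BigDisj Q (\<lambda>p. Gam p \<phi>)"


section \<open>Semantics\<close>

text \<open>
  A structure consists of a universe \<open>U :: 'u set\<close> and the family \<open>P i q\<close> of relations;
  \<open>n\<close>-tuples over \<open>U\<close> are lists, and members of \<open>U\<^sup>\<omega>\<close> are functions on \<^typ>\<open>nat\<close>.
\<close>

definition tuples :: "'u set \<Rightarrow> nat \<Rightarrow> 'u list set" where
  "tuples U n = {xs. length xs = n \<and> set xs \<subseteq> U}"

definition seqs :: "'u set \<Rightarrow> (nat \<Rightarrow> 'u) set" where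
  "seqs U = {s. \<forall>k. s k \<in> U}"

definition is_structure ::
    "('i \<Rightarrow> nat) \<Rightarrow> 'u set \<Rightarrow> ('i \<Rightarrow> 'm \<Rightarrow> 'u list set) \<Rightarrow> bool" where
  "is_structure ar U P \<longleftrightarrow>
     U \<noteq> {} \<and>
     (\<forall>i. (\<forall>p q. p \<noteq> q \<longrightarrow> P i p \<inter> P i q = {}) \<and> (\<Union>q. P i q) = tuples U (ar i))"

definition cyl :: "'u set \<Rightarrow> nat \<Rightarrow> (nat \<Rightarrow> 'u) set \<Rightarrow> (nat \<Rightarrow> 'u) set" where
  "cyl U k X = {s \<in> seqs U. \<exists>x\<in>U. s(k := x) \<in> X}"

text \<open>\<open>den U P \<phi> q\<close> is the \<open>q\<close>-component of the meaning of \<open>\<phi>\<close>.\<close>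

primrec den :: "'u set \<Rightarrow> ('i \<Rightarrow> 'm \<Rightarrow> 'u list set) \<Rightarrow>
    ('i, 'm::{finite,de_morgan_algebra}) fm \<Rightarrow> 'm \<Rightarrow> (nat \<Rightarrow> 'u) set" where
  "den U P (Rel i ks) = (\<lambda>q. {s \<in> seqs U. map s ks \<in> P i q})"
| "den U P (Eql j k) = (\<lambda>p.
     if p = top then {s \<in> seqs U. s j = s k}
     else if p = bot then seqs U - {s \<in> seqs U. s j = s k}
     else {})"
| "den U P (Tv p) = (\<lambda>q. if q = p then seqs U else {})"
| "den U P (Neg \<phi>) = (\<lambda>p. den U P \<phi> (- p))"
| "den U P (Conj \<phi> \<theta>) = (\<lambda>p. \<Union>(q, r)\<in>{(q, r). inf q r = p}. den U P \<phi> q \<inter> den U P \<theta> r)"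
| "den U P (Disj \<phi> \<theta>) = (\<lambda>p. \<Union>(q, r)\<in>{(q, r). sup q r = p}. den U P \<phi> q \<inter> den U P \<theta> r)"
| "den U P (Exists k \<phi>) = (\<lambda>p.
     (\<Union>A\<in>{A. A \<noteq> {} \<and> Sup_fin A = p}. \<Inter>q\<in>A. cyl U k (den U P \<phi> q)) -
     (\<Union>A\<in>{A. A \<noteq> {} \<and> Sup_fin A > p}. \<Inter>q\<in>A. cyl U k (den U P \<phi> q)))"
| "den U P (Gam p \<phi>) = (\<lambda>q.
     if q = top then den U P \<phi> p
     else if q = bot then seqs U - den U P \<phi> p
     else {})"

definition true_in ::
    "'u set \<Rightarrow> ('i \<Rightarrow> 'm \<Rightarrow> 'u list set) \<Rightarrow> ('i, 'm::{finite,de_morgan_algebra}) fm \<Rightarrow> bool" where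
  "true_in U P \<phi> \<longleftrightarrow> den U P \<phi> top = seqs U"

definition Q_true_in ::
    "'m set \<Rightarrow> 'u set \<Rightarrow> ('i \<Rightarrow> 'm \<Rightarrow> 'u list set) \<Rightarrow>
      ('i, 'm::{finite,de_morgan_algebra}) fm \<Rightarrow> bool" where
  "Q_true_in Q U P \<phi> \<longleftrightarrow> (\<Union>p\<in>Q. den U P \<phi> p) = seqs U"

text \<open>
  Semantic consequence, with the universes of structures ranging over all nonempty subsets of
  the type \<^typ>\<open>'u\<close>.  HOL cannot quantify over all types here, so \<^typ>\<open>'u\<close> is a parameter; it
  has to be large enough (e.g. at least as large as the set of formulas) for this to agree with
  consequence over structures of every cardinality.
\<close>

definition entails :: "'u itself \<Rightarrow> ('i \<Rightarrow> nat) \<Rightarrow>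
    ('i, 'm::{finite,de_morgan_algebra}) fm set \<Rightarrow> ('i, 'm) fm \<Rightarrow> bool" where
  "entails TYPE('u) ar \<Sigma> \<phi> \<longleftrightarrow>
     (\<forall>(U :: 'u set) P. is_structure ar U P \<longrightarrow>
        (\<forall>\<sigma>\<in>\<Sigma>. true_in U P \<sigma>) \<longrightarrow> true_in U P \<phi>)"

definition Q_entails :: "'u itself \<Rightarrow> ('i \<Rightarrow> nat) \<Rightarrow> 'm set \<Rightarrow>
    ('i, 'm::{finite,de_morgan_algebra}) fm set \<Rightarrow> ('i, 'm) fm \<Rightarrow> bool" where
  "Q_entails TYPE('u) ar Q \<Sigma> \<phi> \<longleftrightarrow>
     (\<forall>(U :: 'u set) P. is_structure ar U P \<longrightarrow>
        (\<forall>\<sigma>\<in>\<Sigma>. Q_true_in Q U P \<sigma>) \<longrightarrow> Q_true_in Q U P \<phi>)"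


section \<open>Tautologies\<close>

text \<open>Valuations are total functions on formulas; only their values at prime formulas (those
  built by \<open>Exists\<close>, \<open>Eql\<close>, \<open>Rel\<close>) are used.\<close>

primrec tval :: "('i, 'm::de_morgan_algebra) fm \<Rightarrow> (('i, 'm) fm \<Rightarrow> 'm) \<Rightarrow> 'm" where
  "tval (Rel i ks) v = v (Rel i ks)"
| "tval (Eql j k) v = v (Eql j k)"
| "tval (Tv p) v = p"
| "tval (Neg \<phi>) v = - tval \<phi> v"
| "tval (Conj \<phi> \<theta>) v = inf (tval \<phi> v) (tval \<theta> v)"
| "tval (Disj \<phi> \<theta>) v = sup (tval \<phi> v) (tval \<theta> v)"
| "tval (Exists k \<phi>) v = v (Exists k \<phi>)"
| "tval (Gam p \<phi>) v = (if tval \<phi> v = p then top else bot)"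

definition tautology :: "('i, 'm::de_morgan_algebra) fm \<Rightarrow> bool" where
  "tautology \<phi> \<longleftrightarrow> (\<forall>v. tval \<phi> v = top)"


section \<open>Proof system\<close>

inductive is_axiom :: "('i \<Rightarrow> nat) \<Rightarrow> ('i, 'm::{finite,de_morgan_algebra}) fm \<Rightarrow> bool"
  for ar :: "'i \<Rightarrow> nat" where
  taut: "tautology \<phi> \<Longrightarrow> is_axiom ar \<phi>"
| all_inst: "is_axiom ar (GGam (Forall k \<phi>) \<^bold>\<rightarrow> (Forall k \<phi> \<^bold>\<rightarrow> \<phi>))"
| Gam_Exists_Gam: "is_axiom ar (Gam top (Exists k (Gam top \<phi>)) \<^bold>\<Leftrightarrow> Exists k (Gam top \<phi>))"
| Gam_top_Eql: "is_axiom ar (Gam top (Eql k l) \<^bold>\<Leftrightarrow> Eql k l)"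
| Gam_Eql: "p \<notin> {bot, top} \<Longrightarrow> is_axiom ar (Gam p (Eql k l) \<^bold>\<Leftrightarrow> Tv bot)"
| Gam_bot_Eql: "is_axiom ar (Gam bot (Eql k l) \<^bold>\<Leftrightarrow> Neg (Eql k l))"
| Exists_bot: "is_axiom ar (Exists k (Tv bot) \<^bold>\<Leftrightarrow> Tv bot)"
| Exists_above: "is_axiom ar (Disj \<phi> (Exists k \<phi>) \<^bold>\<Leftrightarrow> Exists k \<phi>)"
| Exists_Conj_Exists: "is_axiom ar (Exists k (Conj \<phi> (Exists k \<theta>)) \<^bold>\<Leftrightarrow> Conj (Exists k \<phi>) (Exists k \<theta>))"
| Exists_swap: "is_axiom ar (Exists k (Exists l \<phi>) \<^bold>\<Leftrightarrow> Exists l (Exists k \<phi>))"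
| Eql_same: "is_axiom ar (Eql k k \<^bold>\<Leftrightarrow> Tv top)"
| Eql_Exists: "k \<notin> {l, m} \<Longrightarrow>
    is_axiom ar (Eql l m \<^bold>\<Leftrightarrow> Exists k (Conj (Eql l k) (Eql k m)))"
| Eql_unique: "k \<noteq> l \<Longrightarrow>
    is_axiom ar (Conj (Exists k (Conj (Eql k l) (Gam top \<phi>))) (Exists k (Conj (Eql k l) (Neg (Gam top \<phi>))))
      \<^bold>\<Leftrightarrow> Tv bot)"
| Gam_Exists: "is_axiom ar (Gam p (Exists k \<phi>) \<^bold>\<Leftrightarrow>
    Conj (BigDisj {A. A \<noteq> {} \<and> Sup_fin A = p} (\<lambda>A. BigConj A (\<lambda>q. Exists k (Gam q \<phi>))))
         (Neg (BigDisj {A. A \<noteq> {} \<and> Sup_fin A > p} (\<lambda>A. BigConj A (\<lambda>q. Exists k (Gam q \<phi>))))))"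
| Rel_Sub: "\<lbrakk>length js = ar i; length ks = ar i; distinct ks;
      set ks \<inter> ({0..<ar i} \<union> set js) = {}\<rbrakk> \<Longrightarrow>
    is_axiom ar (Rel i js \<^bold>\<Leftrightarrow>
      foldr (\<lambda>(k, j). Sub k j) (zip ks js)
        (foldr (\<lambda>(m, k). Sub m k) (zip [0..<ar i] ks) (Rel i [0..<ar i])))"

text \<open>\<open>by_rule S \<psi>\<close>: some rule yields \<open>\<psi>\<close> from premises in \<open>S\<close>.\<close>

inductive by_rule ::
    "('i, 'm::{finite,de_morgan_algebra}) fm set \<Rightarrow> ('i, 'm) fm \<Rightarrow> bool"
  for S :: "('i, 'm) fm set" where
  modus_ponens: "\<phi> \<in> S \<Longrightarrow> (\<phi> \<^bold>\<rightarrow> \<theta>) \<in> S \<Longrightarrow> by_rule S \<theta>"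
| GGam_rule: "\<phi> \<in> S \<Longrightarrow> by_rule S (GGam \<phi>)"
| Exists_rule: "(\<theta> \<^bold>\<Rightarrow> \<phi>) \<in> S \<Longrightarrow> k \<notin> Fv \<phi> \<Longrightarrow> by_rule S (Exists k \<theta> \<^bold>\<Rightarrow> \<phi>)"

definition is_proof :: "('i \<Rightarrow> nat) \<Rightarrow> ('i, 'm::{finite,de_morgan_algebra}) fm set \<Rightarrow>
    ('i, 'm) fm list \<Rightarrow> bool" where
  "is_proof ar \<Sigma> \<psi>s \<longleftrightarrow>
     (\<forall>n<length \<psi>s. \<psi>s ! n \<in> formulas ar \<and>
        (\<psi>s ! n \<in> \<Sigma> \<or> is_axiom ar (\<psi>s ! n) \<or> by_rule (set (take n \<psi>s)) (\<psi>s ! n)))"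

definition proves :: "('i \<Rightarrow> nat) \<Rightarrow> ('i, 'm::{finite,de_morgan_algebra}) fm set \<Rightarrow>
    ('i, 'm) fm \<Rightarrow> bool" where
  "proves ar \<Sigma> \<phi> \<longleftrightarrow> (\<exists>\<psi>s. \<psi>s \<noteq> [] \<and> last \<psi>s = \<phi> \<and> is_proof ar \<Sigma> \<psi>s)"

definition Q_proves :: "('i \<Rightarrow> nat) \<Rightarrow> 'm set \<Rightarrow>
    ('i, 'm::{finite,de_morgan_algebra}) fm set \<Rightarrow> ('i, 'm) fm \<Rightarrow> bool" where
  "Q_proves ar Q \<Sigma> \<phi> \<longleftrightarrow> proves ar (Qfm Q ` \<Sigma>) (Qfm Q \<phi>)"

end

theory Submission
  imports Defs
begin

text \<open>
  Completeness is proved in contrapositive form: if \<open>\<phi>\<close> cannot be derived from \<open>\<Sigma>\<close>, a model of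
  \<open>\<Sigma>\<close> in which \<open>\<phi>\<close> is not true is built with universe in the type \<open>'u\<close>.

  The calculus is studied through its propositional part.  A \<^emph>\<open>point\<close> of \<open>\<Sigma>\<close> is a valuation of the
  prime formulas at which every theorem of \<open>\<Sigma>\<close> has value \<open>top\<close>.  A formula with value \<open>top\<close> at all
  points is derivable (\<open>derivable_if_top_at_points\<close>): by compactness it is a tautological consequence
  of finitely many theorems.  So derivations can be replaced by comparisons of values at points.  In
  these terms an axiom \<open>\<theta> \<Leftrightarrow> \<phi>\<close> is an equality, the \<open>\<exists>\<close>-rule makes \<open>\<exists>v\<^sub>k \<theta>\<close> the least upper bound of
  \<open>\<theta>\<close> among the formulas in which \<open>v\<^sub>k\<close> is not free, and the two-valued formulas satisfy the laws of a
  locally finite cylindric algebra.  The axioms mention substitution only in the form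
  \<open>\<exists>v\<^sub>k (v\<^sub>k \<approx> v\<^sub>l \<and> \<theta>)\<close>.  This operator is shown to commute with all connectives; for an \<open>M\<close>-valued
  \<open>\<theta>\<close> the reason is that at each point exactly one of the substituted two-valued formulas \<open>\<gamma>\<^sub>q \<theta>\<close> holds
  (\<open>tval_Sub_Gam\<close>).  An induction on formulas then identifies it with ordinary capture-avoiding
  substitution (\<open>Sub_sub\<close>), so that the theorems are closed under renaming of variables and equality
  is a congruence.

  The model is of Henkin type.  Variables are countable in number while the language need not be, so
  the witnesses cannot be variables.  A formula with constants is instead a pair of a formula \<open>\<theta>\<close> and
  an assignment \<open>a\<close> of constants to variables.  For any finite set \<open>D\<close> of constants there is room to
  name its members by distinct variables, and a point that satisfies the Henkin conditions of \<open>D\<close>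
  under this naming (\<open>ex_henkin_point\<close>) gives a value to every pair \<open>(\<theta>, a)\<close>.  As \<open>M\<close> is finite, these
  values have a limit \<open>w\<close> along the finite sets \<open>D\<close> (\<open>ex_henkin_limit\<close>).  A relation between finitely
  many values that holds at all points, or as soon as \<open>D\<close> is large enough, passes to \<open>w\<close>; hence \<open>w\<close>
  obeys the clauses of the semantics, and the constants modulo provable equality form the model
  (\<open>truth\<close>).  Constants are coded injectively by formulas, which is why the universe fits into \<open>'u\<close>.

  The statement about \<open>Q\<close> reduces to the one about truth, because \<open>\<psi>\<close> is \<open>Q\<close>-true in a structure
  exactly when \<open>\<psi>\<^sup>Q\<close> is true in it.
\<close>

section \<open>Compactness for finitely many values\<close>

text \<open>Tychonoff's theorem for powers of a finite discrete space, in its combinatorial form: a maximal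
  finitely satisfiable family of conditions contains for each \<open>x\<close> one condition \<open>v x = q\<close>, as
  otherwise finitely many members of it would rule out each of the finitely many values; these values
  form the solution.\<close>

lemma finite_support_compactness:
  fixes C :: "(('x \<Rightarrow> 'm::finite) \<Rightarrow> bool) set"
  assumes support: "\<And>P. P \<in> C \<Longrightarrow>
      \<exists>S. finite S \<and> (\<forall>v w. (\<forall>x\<in>S. v x = w x) \<longrightarrow> P v \<longrightarrow> P w)"
    and satisfiable: "\<And>D. finite D \<Longrightarrow> D \<subseteq> C \<Longrightarrow> \<exists>v. \<forall>P\<in>D. P v"
  shows "\<exists>v. \<forall>P\<in>C. P v"
proof -
  define sat where "sat F \<longleftrightarrow> (\<forall>D. finite D \<longrightarrow> D \<subseteq> F \<longrightarrow> (\<exists>v. \<forall>P\<in>D. P v))"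
    for F :: "(('x \<Rightarrow> 'm) \<Rightarrow> bool) set"
  have satD: "\<exists>v. \<forall>P\<in>D. P v" if "sat F" "finite D" "D \<subseteq> F" for F D
    using that unfolding sat_def by blast
  define FS where "FS = {F. C \<subseteq> F \<and> sat F}"
  have "\<exists>F\<in>FS. \<forall>G\<in>FS. F \<subseteq> G \<longrightarrow> G = F"
  proof (rule subset_Zorn_nonempty)
    have "C \<in> FS" using satisfiable by (simp add: FS_def sat_def)
    then show "FS \<noteq> {}" by blast
  next
    fix \<C> assume ne: "\<C> \<noteq> {}" and chain: "subset.chain FS \<C>"
    have sub: "\<C> \<subseteq> FS" using chain by (simp add: subset_chain_def)
    have "\<exists>v. \<forall>P\<in>D. P v" if D: "finite D" "D \<subseteq> \<Union>\<C>" for D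
    proof -
      obtain F where "F \<in> \<C>" "D \<subseteq> F"
        using finite_subset_Union_chain[OF D ne chain] .
      moreover from this have "sat F" using sub by (auto simp: FS_def)
      ultimately show ?thesis using satD D(1) by simp
    qed
    then have "sat (\<Union>\<C>)" by (simp add: sat_def)
    moreover have "C \<subseteq> \<Union>\<C>" using ne sub by (auto simp: FS_def)
    ultimately show "\<Union>\<C> \<in> FS" by (simp add: FS_def)
  qed
  then obtain F where "F \<in> FS" and maximal: "\<And>G. G \<in> FS \<Longrightarrow> F \<subseteq> G \<Longrightarrow> G = F"
    by meson
  then have F: "C \<subseteq> F" "sat F" by (simp_all add: FS_def)
  have "\<exists>q. (\<lambda>v. v x = q) \<in> F" for x
  proof (rule ccontr)
    assume none: "\<not> ?thesis"
    have "\<exists>D. finite D \<and> D \<subseteq> insert (\<lambda>v. v x = q) F \<and> \<not> (\<exists>v. \<forall>P\<in>D. P v)" for q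
    proof -
      have "insert (\<lambda>v. v x = q) F \<notin> FS"
        using maximal[of "insert (\<lambda>v. v x = q) F"] none by auto
      then have "\<not> sat (insert (\<lambda>v. v x = q) F)" using F(1) by (auto simp: FS_def)
      then show ?thesis unfolding sat_def by meson
    qed
    then obtain D where D: "\<And>q. finite (D q)" "\<And>q. D q \<subseteq> insert (\<lambda>v. v x = q) F"
        "\<And>q. \<not> (\<exists>v. \<forall>P\<in>D q. P v)"
      by metis
    let ?E = "\<Union>q. D q - {\<lambda>v. v x = q}"
    have "finite ?E" using D(1) by simp
    moreover have "D q - {\<lambda>v. v x = q} \<subseteq> F" for q using D(2)[of q] by blast
    then have "?E \<subseteq> F" by (rule UN_least)
    ultimately obtain v where v: "\<forall>P\<in>?E. P v" using satD[OF F(2)] by meson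
    have "P v" if "P \<in> D (v x)" for P
      using v that by (cases "P = (\<lambda>w. w x = v x)") auto
    then show False using D(3)[of "v x"] by meson
  qed
  then obtain w where w: "\<And>x. (\<lambda>v. v x = w x) \<in> F" by metis
  have "P w" if P: "P \<in> C" for P
  proof -
    obtain S where S: "finite S" "\<And>v w. (\<forall>x\<in>S. v x = w x) \<Longrightarrow> P v \<Longrightarrow> P w"
      using support[OF P] by auto
    let ?D = "insert P ((\<lambda>x v. v x = w x) ` S)"
    have "P \<in> F" using F(1) P by (rule subsetD)
    then have "?D \<subseteq> F" using w by (simp add: image_subset_iff)
    moreover have "finite ?D" using S(1) by simp
    ultimately obtain v where v: "\<forall>P\<in>?D. P v" using satD[OF F(2)] by meson
    then have "\<forall>x\<in>S. v x = w x" by simp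
    then show "P w" using S(2) v by simp
  qed
  then show ?thesis by meson
qed

text \<open>The limit of a family \<open>W\<close> along an ultrafilter that contains the sets \<open>{E. D \<subseteq> E}\<close>, without the
  ultrafilter: what is used of the limit \<open>w\<close> is that on finitely many arguments it looks like \<open>W E\<close> for
  arbitrarily large finite \<open>E\<close>.\<close>

corollary limit_along_finite_sets:
  fixes W :: "'d set \<Rightarrow> 'x \<Rightarrow> 'm::finite"
  shows "\<exists>w. \<forall>X D. finite X \<longrightarrow> finite D \<longrightarrow>
    (\<exists>E. finite E \<and> D \<subseteq> E \<and> (\<forall>x\<in>X. w x = W E x))"
proof -
  define P where "P X D w \<longleftrightarrow> (\<exists>E. finite E \<and> D \<subseteq> E \<and> (\<forall>x\<in>X. w x = W E x))" for X D w
  let ?fin = "{(X, D). finite X \<and> finite D}"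
  have "\<exists>w. \<forall>R\<in>(\<lambda>(X, D). P X D) ` ?fin. R w"
  proof (rule finite_support_compactness)
    fix R assume "R \<in> (\<lambda>(X, D). P X D) ` ?fin"
    then obtain X D where X: "finite X" and R: "R = P X D" by auto
    have "P X D w" if "\<forall>x\<in>X. v x = w x" "P X D v" for v w
      using that by (simp add: P_def)
    then show "\<exists>S. finite S \<and> (\<forall>v w. (\<forall>x\<in>S. v x = w x) \<longrightarrow> R v \<longrightarrow> R w)"
      unfolding R using X by (intro exI[of _ X]) simp
  next
    fix Rs assume "finite Rs" "Rs \<subseteq> (\<lambda>(X, D). P X D) ` ?fin"
    then obtain J where J: "J \<subseteq> ?fin" "finite J" "Rs = (\<lambda>(X, D). P X D) ` J"
      by (meson finite_subset_image)
    define E where "E = (\<Union>(X, D)\<in>J. D)"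
    have "finite E" using J(1,2) unfolding E_def by (intro finite_UN_I) auto
    then have "P X D (W E)" if "(X, D) \<in> J" for X D
      using that unfolding P_def E_def by (intro exI[of _ E]) (auto simp: E_def)
    then show "\<exists>v. \<forall>R\<in>Rs. R v" unfolding J(3) by (intro exI[of _ "W E"]) auto
  qed
  then obtain w where w: "\<forall>R\<in>(\<lambda>(X, D). P X D) ` ?fin. R w" by (elim exE)
  have "P X D w" if "finite X" "finite D" for X D
    using w that by (simp add: Ball_def image_iff) blast
  then show ?thesis unfolding P_def by (intro exI[of _ w] allI impI)
qed

section \<open>Values of the derived connectives\<close>

lemma uminus_bot: "- (bot::'m::de_morgan_algebra) = top"
  by (metis inf_bot_left sup_top_right uminus_inf uminus_uminus)

lemma uminus_top: "- (top::'m::de_morgan_algebra) = bot"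
  by (metis uminus_bot uminus_uminus)

lemmas bot_top_simps = uminus_bot uminus_top bot_neq_top bot_neq_top[symmetric]

lemma set_enum_set: "finite A \<Longrightarrow> set (enum_set A) = A"
  unfolding enum_set_def using finite_distinct_list[of A] by (metis (mono_tags, lifting) someI_ex)

lemma tval_disj_list:
  "(\<And>\<psi>. \<psi> \<in> set \<psi>s \<Longrightarrow> tval \<psi> v \<in> {bot, top}) \<Longrightarrow>
     tval (disj_list \<psi>s) v = (if \<exists>\<psi>\<in>set \<psi>s. tval \<psi> v = top then top else bot)"
  by (induction \<psi>s rule: disj_list.induct) (auto simp: bot_top_simps)

lemma tval_conj_list:
  "(\<And>\<psi>. \<psi> \<in> set \<psi>s \<Longrightarrow> tval \<psi> v \<in> {bot, top}) \<Longrightarrow>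
     tval (conj_list \<psi>s) v = (if \<forall>\<psi>\<in>set \<psi>s. tval \<psi> v = top then top else bot)"
  by (induction \<psi>s rule: conj_list.induct) (auto simp: bot_top_simps)

lemma tval_BigDisj:
  assumes "finite A" "\<And>x. x \<in> A \<Longrightarrow> tval (f x) v \<in> {bot, top}"
  shows "tval (BigDisj A f) v = (if \<exists>x\<in>A. tval (f x) v = top then top else bot)"
  unfolding BigDisj_def using assms by (subst tval_disj_list) (auto simp: set_enum_set)

lemma tval_BigConj:
  assumes "finite A" "\<And>x. x \<in> A \<Longrightarrow> tval (f x) v \<in> {bot, top}"
  shows "tval (BigConj A f) v = (if \<forall>x\<in>A. tval (f x) v = top then top else bot)"
  unfolding BigConj_def using assms by (subst tval_conj_list) (auto simp: set_enum_set)

lemma Fv_disj_list: "Fv (disj_list \<psi>s) = \<Union> (Fv ` set \<psi>s)"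
  by (induction \<psi>s rule: disj_list.induct) auto

lemma Fv_BigDisj: "finite A \<Longrightarrow> Fv (BigDisj A f) = (\<Union>x\<in>A. Fv (f x))"
  by (simp add: BigDisj_def Fv_disj_list set_enum_set)

lemma tval_Imp_eq_top:
  "tval \<psi> v \<in> {bot, top} \<Longrightarrow>
     tval (\<psi> \<^bold>\<rightarrow> \<theta>) v = top \<longleftrightarrow> (tval \<psi> v = top \<longrightarrow> tval \<theta> v = top)"
  by (auto simp: Imp_def bot_top_simps)

lemma tval_Leq:
  "tval (\<theta> \<^bold>\<Rightarrow> \<phi>) v = (if tval \<theta> v \<le> tval \<phi> v then top else bot)"
proof -
  have D: "tval (BigDisj {q. q \<le> r} (\<lambda>q. Gam q \<theta>)) v = (if tval \<theta> v \<le> r then top else bot)" for r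
    by (subst tval_BigDisj) (auto simp: bot_top_simps)
  show ?thesis unfolding Leq_def
    by (subst tval_BigConj) (auto simp: Imp_def D bot_top_simps)
qed

lemma tval_Leq_eq_top: "tval (\<theta> \<^bold>\<Rightarrow> \<phi>) v = top \<longleftrightarrow> tval \<theta> v \<le> tval \<phi> v"
  by (simp add: tval_Leq bot_top_simps)

lemma tval_Equiv_eq_top: "tval (\<theta> \<^bold>\<Leftrightarrow> \<phi>) v = top \<longleftrightarrow> tval \<theta> v = tval \<phi> v"
  by (auto simp: Equiv_def tval_Leq bot_top_simps)

text \<open>The prime formulas on which the value of a formula depends; a subformula below a quantifier
  is hidden from valuations.\<close>

primrec primes :: "('i, 'm) fm \<Rightarrow> ('i, 'm) fm set" where
  "primes (Rel i ks) = {Rel i ks}"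
| "primes (Eql j k) = {Eql j k}"
| "primes (Tv p) = {}"
| "primes (Neg \<phi>) = primes \<phi>"
| "primes (Conj \<phi> \<theta>) = primes \<phi> \<union> primes \<theta>"
| "primes (Disj \<phi> \<theta>) = primes \<phi> \<union> primes \<theta>"
| "primes (Exists k \<phi>) = {Exists k \<phi>}"
| "primes (Gam p \<phi>) = primes \<phi>"

lemma finite_primes: "finite (primes \<phi>)"
  by (induction \<phi>) auto

lemma tval_cong: "(\<And>\<psi>. \<psi> \<in> primes \<phi> \<Longrightarrow> v \<psi> = w \<psi>) \<Longrightarrow> tval \<phi> v = tval \<phi> w"
  by (induction \<phi>) auto

section \<open>The calculus without arities\<close>

text \<open>Derivability without the requirement that formulas respect the arities.  In exchange, atoms of
  wrong arity are declared equal to \<open>t\<^sub>0\<close>, so that the substitution laws below, which for atoms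
  rest on an axiom for the right arity, hold for all members of the datatype.  Replacing such atoms
  by \<open>t\<^sub>0\<close> turns these derivations into proofs of the original calculus.\<close>

inductive derivable ::
    "('i \<Rightarrow> nat) \<Rightarrow> ('i, 'm::{finite,de_morgan_algebra}) fm set \<Rightarrow> ('i, 'm) fm \<Rightarrow> bool"
  for ar :: "'i \<Rightarrow> nat" and \<Sigma> :: "('i, 'm) fm set" where
  hyp: "\<phi> \<in> \<Sigma> \<Longrightarrow> derivable ar \<Sigma> \<phi>"
| ax: "is_axiom ar \<phi> \<Longrightarrow> derivable ar \<Sigma> \<phi>"
| wrong_arity: "length ks \<noteq> ar i \<Longrightarrow> derivable ar \<Sigma> (Rel i ks \<^bold>\<Leftrightarrow> Tv bot)"
| mp: "derivable ar \<Sigma> \<phi> \<Longrightarrow> derivable ar \<Sigma> (\<phi> \<^bold>\<rightarrow> \<theta>) \<Longrightarrow> derivable ar \<Sigma> \<theta>"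
| gg: "derivable ar \<Sigma> \<phi> \<Longrightarrow> derivable ar \<Sigma> (GGam \<phi>)"
| ex: "derivable ar \<Sigma> (\<theta> \<^bold>\<Rightarrow> \<phi>) \<Longrightarrow> k \<notin> Fv \<phi> \<Longrightarrow> derivable ar \<Sigma> (Exists k \<theta> \<^bold>\<Rightarrow> \<phi>)"

primrec repair :: "('i \<Rightarrow> nat) \<Rightarrow> ('i, 'm::de_morgan_algebra) fm \<Rightarrow> ('i, 'm) fm" where
  "repair ar (Rel i ks) = (if length ks = ar i then Rel i ks else Tv bot)"
| "repair ar (Eql j k) = Eql j k"
| "repair ar (Tv p) = Tv p"
| "repair ar (Neg \<phi>) = Neg (repair ar \<phi>)"
| "repair ar (Conj \<phi> \<theta>) = Conj (repair ar \<phi>) (repair ar \<theta>)"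
| "repair ar (Disj \<phi> \<theta>) = Disj (repair ar \<phi>) (repair ar \<theta>)"
| "repair ar (Exists k \<phi>) = Exists k (repair ar \<phi>)"
| "repair ar (Gam p \<phi>) = Gam p (repair ar \<phi>)"

lemma wf_repair: "wf_fm ar (repair ar \<phi>)"
  by (induction \<phi>) auto

lemma repair_wf: "wf_fm ar \<phi> \<Longrightarrow> repair ar \<phi> = \<phi>"
  by (induction \<phi>) auto

lemma Fv_repair: "Fv (repair ar \<phi>) \<subseteq> Fv \<phi>"
  by (induction \<phi>) auto

lemma repair_disj_list: "repair ar (disj_list \<psi>s) = disj_list (map (repair ar) \<psi>s)"
  by (induction \<psi>s rule: disj_list.induct) auto

lemma repair_conj_list: "repair ar (conj_list \<psi>s) = conj_list (map (repair ar) \<psi>s)"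
  by (induction \<psi>s rule: conj_list.induct) auto

lemma repair_BigDisj: "repair ar (BigDisj A f) = BigDisj A (\<lambda>x. repair ar (f x))"
  by (simp add: BigDisj_def repair_disj_list comp_def)

lemma repair_BigConj: "repair ar (BigConj A f) = BigConj A (\<lambda>x. repair ar (f x))"
  by (simp add: BigConj_def repair_conj_list comp_def)

lemma repair_Imp: "repair ar (\<theta> \<^bold>\<rightarrow> \<phi>) = (repair ar \<theta> \<^bold>\<rightarrow> repair ar \<phi>)"
  by (simp add: Imp_def)

lemma repair_Leq: "repair ar (\<theta> \<^bold>\<Rightarrow> \<phi>) = (repair ar \<theta> \<^bold>\<Rightarrow> repair ar \<phi>)"
  by (simp add: Leq_def repair_BigConj repair_BigDisj repair_Imp)

lemma repair_Equiv: "repair ar (\<theta> \<^bold>\<Leftrightarrow> \<phi>) = (repair ar \<theta> \<^bold>\<Leftrightarrow> repair ar \<phi>)"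
  by (simp add: Equiv_def repair_Leq)

lemma repair_GGam: "repair ar (GGam \<phi>) = GGam (repair ar \<phi>)"
  by (simp add: GGam_def)

lemma repair_Forall: "repair ar (Forall k \<phi>) = Forall k (repair ar \<phi>)"
  by (simp add: Forall_def)

lemma repair_Subs:
  "repair ar (foldr (\<lambda>(k, j). Sub k j) kjs \<phi>) = foldr (\<lambda>(k, j). Sub k j) kjs (repair ar \<phi>)"
  by (induction kjs) (auto simp: Sub_def)

lemmas repair_simps = repair_BigDisj repair_BigConj repair_Imp repair_Equiv repair_Leq
  repair_GGam repair_Forall repair_Subs

text \<open>Repairing acts like a substitution for prime formulas, and tautologies are closed under these.\<close>

lemma tval_repair: "tval (repair ar \<phi>) v = tval \<phi> (\<lambda>\<psi>. tval (repair ar \<psi>) v)"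
  by (induction \<phi>) auto

lemma is_axiom_repair: "is_axiom ar \<phi> \<Longrightarrow> is_axiom ar (repair ar \<phi>)"
proof (induction rule: is_axiom.induct)
  case (taut \<phi>)
  then show ?case
    by (intro is_axiom.taut) (simp add: tautology_def tval_repair[of ar \<phi>])
next
  case (Rel_Sub js i ks)
  then show ?case
    using is_axiom.Rel_Sub[of js ar i ks] by (simp add: repair_simps)
qed (auto simp: repair_simps intro: is_axiom.intros[simplified])


text \<open>A derivation only yields \<open>\<phi>\<close>, but a tautological consequence uses the two-valued statement that
  \<open>\<phi>\<close> has value \<open>top\<close>; the \<open>\<Gamma>\<close>-rule bridges this gap.\<close>

lemma Gam_top_derivable:
  assumes "derivable ar \<Sigma> \<phi>"
  shows "derivable ar \<Sigma> (Gam top \<phi>)"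
proof -
  have "tautology (\<phi> \<^bold>\<rightarrow> (GGam \<phi> \<^bold>\<rightarrow> Gam top \<phi>))"
    by (auto simp: tautology_def Imp_def GGam_def bot_top_simps)
  then show ?thesis
    using assms by (blast intro: derivable.mp derivable.gg derivable.ax is_axiom.taut)
qed

lemma by_rule_mono: "by_rule S \<psi> \<Longrightarrow> S \<subseteq> T \<Longrightarrow> by_rule T \<psi>"
  by (induction rule: by_rule.induct) (blast intro: by_rule.intros)+

lemma is_proof_append:
  assumes "is_proof ar \<Sigma> xs" "is_proof ar \<Sigma> ys"
  shows "is_proof ar \<Sigma> (xs @ ys)"
proof -
  show ?thesis
    unfolding is_proof_def
  proof (intro allI impI)
    fix n assume n: "n < length (xs @ ys)"
    show "(xs @ ys) ! n \<in> formulas ar \<and> ((xs @ ys) ! n \<in> \<Sigma> \<or> is_axiom ar ((xs @ ys) ! n)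
        \<or> by_rule (set (take n (xs @ ys))) ((xs @ ys) ! n))"
    proof (cases "n < length xs")
      case True
      then show ?thesis using assms(1) by (simp add: is_proof_def nth_append)
    next
      case False
      then have "(xs @ ys) ! n = ys ! (n - length xs)" "n - length xs < length ys"
        "set (take (n - length xs) ys) \<subseteq> set (take n (xs @ ys))"
        using n by (auto simp: nth_append)
      then show ?thesis using assms(2) by_rule_mono unfolding is_proof_def by metis
    qed
  qed
qed

lemma is_proof_snoc:
  assumes "is_proof ar \<Sigma> xs" "\<psi> \<in> formulas ar" "\<psi> \<in> \<Sigma> \<or> is_axiom ar \<psi> \<or> by_rule (set xs) \<psi>"
  shows "is_proof ar \<Sigma> (xs @ [\<psi>])"
  using assms by (auto simp: is_proof_def nth_append less_Suc_eq)

lemma proves_hyp_or_axiom: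
  assumes "\<psi> \<in> formulas ar" "\<psi> \<in> \<Sigma> \<or> is_axiom ar \<psi>"
  shows "proves ar \<Sigma> \<psi>"
  unfolding proves_def using assms by (intro exI[of _ "[\<psi>]"]) (auto simp: is_proof_def)

text \<open>No rule has more than two premises, so it suffices to concatenate two proofs.\<close>

lemma proves_by_rule:
  assumes "by_rule S \<psi>" "\<And>\<theta>. \<theta> \<in> S \<Longrightarrow> proves ar \<Sigma> \<theta>" "S = {\<theta>1, \<theta>2}" "\<psi> \<in> formulas ar"
  shows "proves ar \<Sigma> \<psi>"
proof -
  obtain xs ys where xs: "xs \<noteq> []" "last xs = \<theta>1" "is_proof ar \<Sigma> xs"
    and ys: "ys \<noteq> []" "last ys = \<theta>2" "is_proof ar \<Sigma> ys"
    using assms(2,3) unfolding proves_def by blast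
  have "S \<subseteq> set (xs @ ys)" using xs ys assms(3) by auto
  then have "by_rule (set (xs @ ys)) \<psi>"
    using assms(1) by_rule_mono by blast
  then have "is_proof ar \<Sigma> ((xs @ ys) @ [\<psi>])"
    using is_proof_snoc[OF is_proof_append[OF xs(3) ys(3)]] assms(4) by blast
  then show ?thesis unfolding proves_def by (intro exI[of _ "(xs @ ys) @ [\<psi>]"]) simp
qed

lemma proves_repair:
  assumes "derivable ar \<Sigma> \<phi>" "\<Sigma> \<subseteq> formulas ar"
  shows "proves ar \<Sigma> (repair ar \<phi>)"
  using assms(1)
proof induction
  case (hyp \<phi>)
  then have "repair ar \<phi> = \<phi>" using assms(2) by (auto simp: formulas_def intro: repair_wf)
  then show ?case using hyp assms(2) by (auto intro: proves_hyp_or_axiom)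
next
  case (ax \<phi>)
  then show ?case by (auto simp: formulas_def wf_repair intro: proves_hyp_or_axiom is_axiom_repair)
next
  case (wrong_arity ks i)
  have "repair ar (Rel i ks \<^bold>\<Leftrightarrow> Tv bot) = (Tv bot \<^bold>\<Leftrightarrow> Tv bot)"
    using wrong_arity by (simp add: repair_simps)
  moreover have "is_axiom ar (Tv bot \<^bold>\<Leftrightarrow> Tv bot)"
    by (auto simp: tautology_def tval_Equiv_eq_top intro: is_axiom.taut)
  ultimately show ?case
    using wf_repair by (metis formulas_def mem_Collect_eq proves_hyp_or_axiom)
next
  case (mp \<phi> \<theta>)
  have "by_rule {repair ar \<phi>, repair ar (\<phi> \<^bold>\<rightarrow> \<theta>)} (repair ar \<theta>)"
    by (rule by_rule.modus_ponens[of "repair ar \<phi>"]) (auto simp: repair_simps)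
  then show ?case
    by (rule proves_by_rule) (use mp.IH in \<open>auto simp: formulas_def wf_repair\<close>)
next
  case (gg \<phi>)
  have "by_rule {repair ar \<phi>, repair ar \<phi>} (repair ar (GGam \<phi>))"
    by (auto simp: repair_simps intro: by_rule.GGam_rule)
  then show ?case
    by (rule proves_by_rule) (use gg.IH in \<open>auto simp: formulas_def wf_repair\<close>)
next
  case (ex \<theta> \<phi> k)
  have "by_rule {repair ar (\<theta> \<^bold>\<Rightarrow> \<phi>), repair ar (\<theta> \<^bold>\<Rightarrow> \<phi>)} (repair ar (Exists k \<theta> \<^bold>\<Rightarrow> \<phi>))"
    using ex.hyps Fv_repair by (auto simp: repair_simps intro!: by_rule.Exists_rule)
  then show ?case
    by (rule proves_by_rule) (use ex.IH in \<open>auto simp: formulas_def wf_repair\<close>)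
qed

lemma proves_of_derivable:
  "derivable ar \<Sigma> \<phi> \<Longrightarrow> \<Sigma> \<subseteq> formulas ar \<Longrightarrow> \<phi> \<in> formulas ar \<Longrightarrow> proves ar \<Sigma> \<phi>"
  using proves_repair[of ar \<Sigma> \<phi>] by (simp add: formulas_def repair_wf)

section \<open>Simultaneous substitution\<close>

definition repl :: "nat \<Rightarrow> nat \<Rightarrow> nat \<Rightarrow> nat" where
  "repl k l j = (if j = k then l else j)"

lemma repl_simps [simp]: "repl k l k = l" "j \<noteq> k \<Longrightarrow> repl k l j = j"
  by (simp_all add: repl_def)

definition fresh :: "nat set \<Rightarrow> nat" where
  "fresh N = (LEAST n. n \<notin> N)"

lemma fresh: "finite N \<Longrightarrow> fresh N \<notin> N"
  unfolding fresh_def by (rule LeastI_ex) (rule ex_new_if_finite, simp_all)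

lemma finite_Fv: "finite (Fv \<theta>)"
  by (induction \<theta>) auto

text \<open>The bound variable is always renamed, to a variable that depends only on the images of the free
  variables.  Hence substitutions that agree on the free variables give literally the same formula.\<close>

primrec sub :: "('i, 'm) fm \<Rightarrow> (nat \<Rightarrow> nat) \<Rightarrow> ('i, 'm) fm" where
  "sub (Rel i ks) \<tau> = Rel i (map \<tau> ks)"
| "sub (Eql j k) \<tau> = Eql (\<tau> j) (\<tau> k)"
| "sub (Tv p) \<tau> = Tv p"
| "sub (Neg \<phi>) \<tau> = Neg (sub \<phi> \<tau>)"
| "sub (Conj \<phi> \<theta>) \<tau> = Conj (sub \<phi> \<tau>) (sub \<theta> \<tau>)"
| "sub (Disj \<phi> \<theta>) \<tau> = Disj (sub \<phi> \<tau>) (sub \<theta> \<tau>)"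
| "sub (Exists k \<phi>) \<tau> =
     (let n = fresh (\<tau> ` (Fv \<phi> - {k})) in Exists n (sub \<phi> (\<tau>(k := n))))"
| "sub (Gam p \<phi>) \<tau> = Gam p (sub \<phi> \<tau>)"

lemma sub_cong: "(\<And>j. j \<in> Fv \<theta> \<Longrightarrow> \<tau> j = \<rho> j) \<Longrightarrow> sub \<theta> \<tau> = sub \<theta> \<rho>"
proof (induction \<theta> arbitrary: \<tau> \<rho>)
  case (Exists k \<theta>)
  have "\<tau> ` (Fv \<theta> - {k}) = \<rho> ` (Fv \<theta> - {k})"
    using Exists.prems by (auto intro!: image_cong)
  moreover have "sub \<theta> (\<tau>(k := n)) = sub \<theta> (\<rho>(k := n))" for n
    using Exists.prems by (intro Exists.IH) auto
  ultimately show ?case by (simp add: Let_def)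
next
  case (Conj \<theta>1 \<theta>2)
  have "sub \<theta>1 \<tau> = sub \<theta>1 \<rho>" "sub \<theta>2 \<tau> = sub \<theta>2 \<rho>"
    by (rule Conj.IH, use Conj.prems in auto)+
  then show ?case by (simp only: sub.simps)
next
  case (Disj \<theta>1 \<theta>2)
  have "sub \<theta>1 \<tau> = sub \<theta>1 \<rho>" "sub \<theta>2 \<tau> = sub \<theta>2 \<rho>"
    by (rule Disj.IH, use Disj.prems in auto)+
  then show ?case by (simp only: sub.simps)
next
  case (Neg \<theta>)
  have "sub \<theta> \<tau> = sub \<theta> \<rho>" by (rule Neg.IH) (use Neg.prems in auto)
  then show ?case by (simp only: sub.simps)
next
  case (Gam p \<theta>)
  have "sub \<theta> \<tau> = sub \<theta> \<rho>" by (rule Gam.IH) (use Gam.prems in auto)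
  then show ?case by (simp only: sub.simps)
qed auto

lemma Fv_sub: "Fv (sub \<theta> \<tau>) = \<tau> ` Fv \<theta>"
proof (induction \<theta> arbitrary: \<tau>)
  case (Exists k \<theta>)
  let ?n = "fresh (\<tau> ` (Fv \<theta> - {k}))"
  have "?n \<notin> \<tau> ` (Fv \<theta> - {k})" by (intro fresh finite_imageI finite_Diff finite_Fv)
  then have "(\<tau>(k := ?n)) ` Fv \<theta> - {?n} = \<tau> ` (Fv \<theta> - {k})"
    by (auto simp: image_iff) (metis DiffI singletonD)
  then show ?case using Exists.IH by (simp add: Let_def)
qed auto

section \<open>Points of a theory\<close>

locale calculus =
  fixes ar :: "'i \<Rightarrow> nat" and \<Sigma> :: "('i, 'm::{finite,de_morgan_algebra}) fm set"
begin

definition point :: "(('i, 'm) fm \<Rightarrow> 'm) \<Rightarrow> bool" where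
  "point v \<longleftrightarrow> (\<forall>\<theta>. derivable ar \<Sigma> \<theta> \<longrightarrow> tval \<theta> v = top)"

definition sem_le :: "('i, 'm) fm \<Rightarrow> ('i, 'm) fm \<Rightarrow> bool"  (infix "\<preceq>" 50) where
  "\<theta> \<preceq> \<phi> \<longleftrightarrow> (\<forall>v. point v \<longrightarrow> tval \<theta> v \<le> tval \<phi> v)"

definition sem_eq :: "('i, 'm) fm \<Rightarrow> ('i, 'm) fm \<Rightarrow> bool"  (infix "\<simeq>" 50) where
  "\<theta> \<simeq> \<phi> \<longleftrightarrow> (\<forall>v. point v \<longrightarrow> tval \<theta> v = tval \<phi> v)"

text \<open>The nested implication \<open>\<gamma>\<^sub>1 \<theta>\<^sub>1 \<rightarrow> \<dots> \<rightarrow> \<gamma>\<^sub>1 \<theta>\<^sub>n \<rightarrow> \<chi>\<close> is a tautology.  The guards \<open>\<gamma>\<^sub>1\<close> are essential, as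
  \<open>\<theta> \<rightarrow> \<chi>\<close> can fail to be true when \<open>\<theta>\<close> has an intermediate value.\<close>

lemma derivable_if_taut_consequence:
  assumes "finite T" "\<And>\<theta>. \<theta> \<in> T \<Longrightarrow> derivable ar \<Sigma> \<theta>"
    and "\<And>v. (\<And>\<theta>. \<theta> \<in> T \<Longrightarrow> tval \<theta> v = top) \<Longrightarrow> tval \<chi> v = top"
  shows "derivable ar \<Sigma> \<chi>"
proof -
  obtain \<theta>s where \<theta>s: "set \<theta>s = T" using assms(1) finite_list by blast
  have "tval (foldr (\<lambda>\<theta> \<xi>. Gam top \<theta> \<^bold>\<rightarrow> \<xi>) ts \<chi>) v = top
      \<longleftrightarrow> ((\<forall>\<theta>\<in>set ts. tval \<theta> v = top) \<longrightarrow> tval \<chi> v = top)" for ts v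
    by (induction ts) (auto simp: Imp_def bot_top_simps)
  then have "tautology (foldr (\<lambda>\<theta> \<xi>. Gam top \<theta> \<^bold>\<rightarrow> \<xi>) \<theta>s \<chi>)"
    using assms(3) \<theta>s by (simp add: tautology_def)
  then have "derivable ar \<Sigma> (foldr (\<lambda>\<theta> \<xi>. Gam top \<theta> \<^bold>\<rightarrow> \<xi>) \<theta>s \<chi>)"
    by (intro derivable.ax is_axiom.taut)
  moreover have "\<forall>\<theta>\<in>set \<theta>s. derivable ar \<Sigma> \<theta>" using assms(2) \<theta>s by blast
  ultimately show ?thesis
    by (induction \<theta>s) (auto dest: derivable.mp[OF Gam_top_derivable])
qed

text \<open>Propositional completeness: otherwise each finite set of theorems is true at some valuation at
  which \<open>\<chi>\<close> is not, and a limit of these valuations is a point.\<close>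

lemma derivable_if_top_at_points:
  assumes "\<And>v. point v \<Longrightarrow> tval \<chi> v = top"
  shows "derivable ar \<Sigma> \<chi>"
proof (rule ccontr)
  assume none: "\<not> derivable ar \<Sigma> \<chi>"
  define good where "good T v \<longleftrightarrow>
      (\<forall>\<theta>\<in>T. derivable ar \<Sigma> \<theta> \<longrightarrow> tval \<theta> v = top) \<and> tval \<chi> v \<noteq> top" for T v
  have good: "\<exists>v. good T v" if "finite T" for T
  proof (rule ccontr)
    assume "\<not> ?thesis"
    then have *: "tval \<chi> v = top" if "\<And>\<theta>. \<theta> \<in> {\<theta> \<in> T. derivable ar \<Sigma> \<theta>} \<Longrightarrow> tval \<theta> v = top" for v
      using that unfolding good_def by simp blast
    have "derivable ar \<Sigma> \<chi>"
      by (rule derivable_if_taut_consequence[of "{\<theta> \<in> T. derivable ar \<Sigma> \<theta>}"])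
        (use \<open>finite T\<close> * in simp_all)
    then show False using none by simp
  qed
  define W where "W T = (SOME v. good T v)" for T
  have W: "good T (W T)" if "finite T" for T
    unfolding W_def using good[OF that] by (rule someI_ex)
  obtain w where "\<forall>X D. finite X \<longrightarrow> finite D \<longrightarrow>
      (\<exists>E. finite E \<and> D \<subseteq> E \<and> (\<forall>x\<in>X. w x = W E x))"
    using limit_along_finite_sets[of W] ..
  note w = this[rule_format]
  have "tval \<theta> w = top" if \<theta>: "derivable ar \<Sigma> \<theta>" for \<theta>
  proof -
    obtain E where E: "finite E" "{\<theta>} \<subseteq> E" "\<forall>x\<in>primes \<theta>. w x = W E x"
      using w[of "primes \<theta>" "{\<theta>}"] finite_primes[of \<theta>] by auto
    then have "tval \<theta> w = tval \<theta> (W E)" by (intro tval_cong) simp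
    then show ?thesis using W[of E] E \<theta> by (simp add: good_def)
  qed
  then have "point w" by (simp add: point_def)
  obtain E where E: "finite E" "\<forall>x\<in>primes \<chi>. w x = W E x"
    using w[of "primes \<chi>" "{}"] finite_primes[of \<chi>] by auto
  then have "tval \<chi> w = tval \<chi> (W E)" by (intro tval_cong) simp
  then show False using W[OF E(1)] assms[OF \<open>point w\<close>] by (simp add: good_def)
qed

lemma point_top: "point v \<Longrightarrow> derivable ar \<Sigma> \<theta> \<Longrightarrow> tval \<theta> v = top"
  by (simp add: point_def)

lemma point_axiom: "point v \<Longrightarrow> is_axiom ar \<theta> \<Longrightarrow> tval \<theta> v = top"
  by (auto intro: point_top derivable.ax)

lemma sem_eq_axiom: "is_axiom ar (\<theta> \<^bold>\<Leftrightarrow> \<phi>) \<Longrightarrow> \<theta> \<simeq> \<phi>"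
  using point_axiom tval_Equiv_eq_top unfolding sem_eq_def by blast

lemma sem_le_refl: "\<theta> \<preceq> \<theta>" by (simp add: sem_le_def)
lemma sem_le_trans [trans]: "\<theta> \<preceq> \<phi> \<Longrightarrow> \<phi> \<preceq> \<psi> \<Longrightarrow> \<theta> \<preceq> \<psi>"
  unfolding sem_le_def by (meson order_trans)
lemma sem_eq_refl: "\<theta> \<simeq> \<theta>" by (simp add: sem_eq_def)
lemma sem_eq_sym: "\<theta> \<simeq> \<phi> \<Longrightarrow> \<phi> \<simeq> \<theta>" by (simp add: sem_eq_def)
lemma sem_eq_trans [trans]: "\<theta> \<simeq> \<phi> \<Longrightarrow> \<phi> \<simeq> \<psi> \<Longrightarrow> \<theta> \<simeq> \<psi>" by (simp add: sem_eq_def)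
lemma sem_eq_le: "\<theta> \<simeq> \<phi> \<Longrightarrow> \<theta> \<preceq> \<phi>" by (simp add: sem_eq_def sem_le_def)
lemma sem_eqI: "\<theta> \<preceq> \<phi> \<Longrightarrow> \<phi> \<preceq> \<theta> \<Longrightarrow> \<theta> \<simeq> \<phi>"
  unfolding sem_eq_def sem_le_def by (blast intro: order_antisym)
lemma sem_le_eq_trans [trans]: "\<theta> \<preceq> \<phi> \<Longrightarrow> \<phi> \<simeq> \<psi> \<Longrightarrow> \<theta> \<preceq> \<psi>"
  by (simp add: sem_eq_def sem_le_def)
lemma sem_eq_le_trans [trans]: "\<theta> \<simeq> \<phi> \<Longrightarrow> \<phi> \<preceq> \<psi> \<Longrightarrow> \<theta> \<preceq> \<psi>"
  by (simp add: sem_eq_def sem_le_def)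

lemma derivable_Leq: "\<theta> \<preceq> \<phi> \<Longrightarrow> derivable ar \<Sigma> (\<theta> \<^bold>\<Rightarrow> \<phi>)"
  by (rule derivable_if_top_at_points) (simp add: tval_Leq_eq_top sem_le_def)

section \<open>Cylindrification\<close>

lemma Exists_least: "\<theta> \<preceq> \<phi> \<Longrightarrow> k \<notin> Fv \<phi> \<Longrightarrow> Exists k \<theta> \<preceq> \<phi>"
proof -
  assume "\<theta> \<preceq> \<phi>" "k \<notin> Fv \<phi>"
  then have "derivable ar \<Sigma> (Exists k \<theta> \<^bold>\<Rightarrow> \<phi>)" by (intro derivable.ex derivable_Leq)
  then show ?thesis using point_top tval_Leq_eq_top unfolding sem_le_def by metis
qed

lemma Exists_increasing: "\<theta> \<preceq> Exists k \<theta>"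
proof -
  have "Disj \<theta> (Exists k \<theta>) \<simeq> Exists k \<theta>" by (intro sem_eq_axiom is_axiom.intros)
  then show ?thesis unfolding sem_eq_def sem_le_def by (simp add: sup.absorb_iff2)
qed

lemma Exists_mono: "\<theta> \<preceq> \<phi> \<Longrightarrow> Exists k \<theta> \<preceq> Exists k \<phi>"
  by (rule Exists_least) (erule sem_le_trans[OF _ Exists_increasing], simp)

lemma Exists_cong: "\<theta> \<simeq> \<phi> \<Longrightarrow> Exists k \<theta> \<simeq> Exists k \<phi>"
  by (meson sem_eqI sem_eq_le sem_eq_sym Exists_mono)

lemma Exists_vacuous: "k \<notin> Fv \<theta> \<Longrightarrow> Exists k \<theta> \<simeq> \<theta>"
  by (intro sem_eqI Exists_least Exists_increasing sem_le_refl)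

lemma Conj_cong: "\<theta> \<simeq> \<theta>' \<Longrightarrow> \<phi> \<simeq> \<phi>' \<Longrightarrow> Conj \<theta> \<phi> \<simeq> Conj \<theta>' \<phi>'"
  by (simp add: sem_eq_def)

lemma Exists_Conj_right:
  assumes "k \<notin> Fv \<theta>"
  shows "Exists k (Conj \<phi> \<theta>) \<simeq> Conj (Exists k \<phi>) \<theta>"
proof -
  have "Exists k (Conj \<phi> \<theta>) \<simeq> Exists k (Conj \<phi> (Exists k \<theta>))"
    by (intro Exists_cong Conj_cong sem_eq_refl sem_eq_sym[OF Exists_vacuous] assms)
  also have "\<dots> \<simeq> Conj (Exists k \<phi>) (Exists k \<theta>)"
    by (intro sem_eq_axiom is_axiom.intros)
  also have "\<dots> \<simeq> Conj (Exists k \<phi>) \<theta>"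
    by (intro Conj_cong sem_eq_refl Exists_vacuous assms)
  finally show ?thesis .
qed

lemma Conj_commute: "Conj \<phi> \<theta> \<simeq> Conj \<theta> \<phi>"
  by (simp add: sem_eq_def inf.commute)

lemma Exists_Conj_left:
  assumes "k \<notin> Fv \<theta>"
  shows "Exists k (Conj \<theta> \<phi>) \<simeq> Conj \<theta> (Exists k \<phi>)"
  using Exists_cong[OF Conj_commute] Exists_Conj_right[OF assms] Conj_commute
  by (meson sem_eq_trans)

lemma Exists_commute: "Exists k (Exists l \<theta>) \<simeq> Exists l (Exists k \<theta>)"
  by (intro sem_eq_axiom is_axiom.intros)

text \<open>The two-valued formulas.  Boolean and cylindric algebra is available for them, and an \<open>M\<close>-valued
  formula is reached through the crisp formulas \<open>\<gamma>\<^sub>q \<theta>\<close>.\<close>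

definition crisp :: "('i, 'm) fm \<Rightarrow> bool" where
  "crisp \<theta> \<longleftrightarrow> (\<forall>v. point v \<longrightarrow> tval \<theta> v \<in> {bot, top})"

lemma crisp_Gam: "crisp (Gam p \<theta>)"
  by (simp add: crisp_def)

lemma crisp_Conj: "crisp \<theta> \<Longrightarrow> crisp \<phi> \<Longrightarrow> crisp (Conj \<theta> \<phi>)"
  by (auto simp: crisp_def)

lemma crisp_Gam_top: "crisp \<theta> \<Longrightarrow> Gam top \<theta> \<simeq> \<theta>"
  by (auto simp: crisp_def sem_eq_def bot_top_simps)

lemma crisp_Exists:
  assumes "crisp \<theta>"
  shows "crisp (Exists k \<theta>)"
proof -
  have "Gam top (Exists k (Gam top \<theta>)) \<simeq> Exists k (Gam top \<theta>)"
    by (intro sem_eq_axiom is_axiom.intros)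
  moreover have "Exists k (Gam top \<theta>) \<simeq> Exists k \<theta>"
    by (intro Exists_cong crisp_Gam_top assms)
  ultimately have "Exists k \<theta> \<simeq> Gam top (Exists k (Gam top \<theta>))"
    by (meson sem_eq_sym sem_eq_trans)
  then show ?thesis using crisp_Gam unfolding crisp_def sem_eq_def by metis
qed

lemma crisp_Eql: "crisp (Eql k l)"
proof -
  have "tval (Eql k l) v \<in> {bot, top}" if "point v" for v
  proof (rule ccontr)
    assume p: "tval (Eql k l) v \<notin> {bot, top}"
    then have "Gam (tval (Eql k l) v) (Eql k l) \<simeq> Tv bot"
      by (intro sem_eq_axiom is_axiom.intros)
    then show False using that unfolding sem_eq_def by (auto simp: bot_top_simps)
  qed
  then show ?thesis unfolding crisp_def by blast
qed

lemma crispD: "crisp \<theta> \<Longrightarrow> point v \<Longrightarrow> tval \<theta> v \<noteq> top \<Longrightarrow> tval \<theta> v = bot"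
  by (auto simp: crisp_def)

lemma crispE:
  assumes "crisp \<theta>" "point v"
  obtains "tval \<theta> v = top" | "tval \<theta> v = bot"
  using assms crispD by blast

text \<open>The doubly indexed clause for \<open>\<exists>\<close>, which occurs both in the semantics and in an axiom, just says
  that the value is the supremum of the set \<open>B\<close> of attained values: \<open>B\<close> itself has the largest supremum
  among its subsets.\<close>

lemma Sup_fin_subsets_iff:
  fixes B :: "'m set"
  assumes "B \<noteq> {}"
  shows "(\<exists>A. A \<noteq> {} \<and> Sup_fin A = p \<and> A \<subseteq> B) \<and> \<not> (\<exists>A. A \<noteq> {} \<and> Sup_fin A > p \<and> A \<subseteq> B)
    \<longleftrightarrow> p = Sup_fin B"
proof -
  have "Sup_fin A \<le> Sup_fin B" if "A \<noteq> {}" "A \<subseteq> B" for A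
    using that by (simp add: Sup_fin.subset_imp)
  then show ?thesis using assms by (metis dual_order.refl leD order_le_less)
qed

lemma tval_Exists:
  fixes \<theta> :: "('i, 'm) fm" and k :: nat
  assumes v: "point v"
  defines "B \<equiv> {q. tval (Exists k (Gam q \<theta>)) v = top}"
  shows "B \<noteq> {}" "tval (Exists k \<theta>) v = Sup_fin B"
proof -
  let ?p = "tval (Exists k \<theta>) v"
  have crisp: "tval (Exists k (Gam q \<theta>)) v \<in> {bot, top}" for q
    using crisp_Exists[OF crisp_Gam] v unfolding crisp_def by blast
  have conj: "tval (BigConj A (\<lambda>q. Exists k (Gam q \<theta>))) v = (if A \<subseteq> B then top else bot)" for A
    using crisp by (subst tval_BigConj) (auto simp: B_def)
  have disj: "tval (BigDisj {A. A \<noteq> {} \<and> R A} (\<lambda>A. BigConj A (\<lambda>q. Exists k (Gam q \<theta>)))) v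
      = (if \<exists>A. A \<noteq> {} \<and> R A \<and> A \<subseteq> B then top else bot)" for R
    by (subst tval_BigDisj) (auto simp: conj bot_top_simps)
  let ?D = "\<lambda>R. BigDisj {A. A \<noteq> {} \<and> R A} (\<lambda>A. BigConj A (\<lambda>q. Exists k (Gam q \<theta>)))"
  have "Gam ?p (Exists k \<theta>) \<simeq> Conj (?D (\<lambda>A. Sup_fin A = ?p)) (Neg (?D (\<lambda>A. Sup_fin A > ?p)))"
    by (intro sem_eq_axiom is_axiom.intros)
  then have "tval (Gam ?p (Exists k \<theta>)) v
      = tval (Conj (?D (\<lambda>A. Sup_fin A = ?p)) (Neg (?D (\<lambda>A. Sup_fin A > ?p)))) v"
    using v unfolding sem_eq_def by blast
  then have "inf (tval (?D (\<lambda>A. Sup_fin A = ?p)) v) (- tval (?D (\<lambda>A. Sup_fin A > ?p)) v) = top"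
    by simp
  then have *: "(\<exists>A. A \<noteq> {} \<and> Sup_fin A = ?p \<and> A \<subseteq> B)
      \<and> \<not> (\<exists>A. A \<noteq> {} \<and> Sup_fin A > ?p \<and> A \<subseteq> B)"
    unfolding disj by (simp add: bot_top_simps split: if_split_asm) blast
  then show "B \<noteq> {}" by auto
  then show "?p = Sup_fin B" using * Sup_fin_subsets_iff by simp
qed

section \<open>Substitution of one variable\<close>

lemma Exists_Eql:
  "k \<noteq> l \<Longrightarrow> k \<noteq> m \<Longrightarrow> Exists k (Conj (Eql l k) (Eql k m)) \<simeq> Eql l m"
  by (rule sem_eq_sym[OF sem_eq_axiom[OF is_axiom.Eql_Exists]]) auto

lemma Eql_refl: "point v \<Longrightarrow> tval (Eql k k) v = top"
proof -
  have "Eql k k \<simeq> Tv top" by (intro sem_eq_axiom is_axiom.intros)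
  then show "point v \<Longrightarrow> tval (Eql k k) v = top" by (simp add: sem_eq_def)
qed

lemma Sub_mono: "\<theta> \<preceq> \<phi> \<Longrightarrow> Sub k l \<theta> \<preceq> Sub k l \<phi>"
  unfolding Sub_def by (rule Exists_mono) (auto simp: sem_le_def le_infI2)

lemma Sub_cong: "\<theta> \<simeq> \<phi> \<Longrightarrow> Sub k l \<theta> \<simeq> Sub k l \<phi>"
  by (meson sem_eqI sem_eq_le sem_eq_sym Sub_mono)

lemma Sub_le_Exists: "Sub k l \<theta> \<preceq> Exists k \<theta>"
  unfolding Sub_def by (rule Exists_mono) (simp add: sem_le_def)

lemma Sub_Gam_top_contradictory:
  assumes "k \<noteq> l" "point v"
  shows "inf (tval (Sub k l (Gam top \<theta>)) v) (tval (Sub k l (Neg (Gam top \<theta>))) v) = bot"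
proof -
  have "Conj (Sub k l (Gam top \<theta>)) (Sub k l (Neg (Gam top \<theta>))) \<simeq> Tv bot"
    unfolding Sub_def by (intro sem_eq_axiom is_axiom.intros assms)
  then show ?thesis using assms unfolding sem_eq_def by simp
qed

text \<open>From \<open>\<exists>v\<^sub>k (v\<^sub>l \<approx> v\<^sub>k \<and> v\<^sub>k \<approx> v\<^sub>l) \<Leftrightarrow> v\<^sub>l \<approx> v\<^sub>l\<close> it follows that \<open>v\<^sub>l \<approx> v\<^sub>k\<close> becomes true when \<open>v\<^sub>l\<close> is
  substituted for \<open>v\<^sub>k\<close>.  By the uniqueness axiom for substitution its negation then becomes false,
  so no assignment satisfies \<open>v\<^sub>k \<approx> v\<^sub>l \<and> \<not> v\<^sub>l \<approx> v\<^sub>k\<close>.\<close>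

lemma Eql_sym_le: "Eql k l \<preceq> Eql l k"
proof (cases "k = l")
  case False
  let ?\<theta> = "Gam top (Eql l k)"
  have \<theta>: "?\<theta> \<simeq> Eql l k" by (intro crisp_Gam_top crisp_Eql)
  have "Sub k l ?\<theta> \<simeq> Exists k (Conj (Eql l k) (Eql k l))"
    unfolding Sub_def using \<theta> by (intro Exists_cong) (auto simp: sem_eq_def inf.commute)
  also have "\<dots> \<simeq> Eql l l" using False by (intro Exists_Eql) auto
  finally have 1: "tval (Sub k l ?\<theta>) v = top" if "point v" for v
    using Eql_refl that unfolding sem_eq_def by metis
  have "Conj (Eql k l) (Neg ?\<theta>) \<preceq> Sub k l (Neg ?\<theta>)"
    unfolding Sub_def by (rule Exists_increasing)
  then have "inf (tval (Eql k l) v) (tval (Neg ?\<theta>) v) = bot" if "point v" for v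
    using Sub_Gam_top_contradictory[OF False that, of "Eql l k"] 1[OF that] that
    unfolding sem_le_def by (metis bot.extremum_uniqueI inf_top_left tval.simps(5))
  then show ?thesis
    unfolding sem_le_def
    using crispD[OF crisp_Eql, of _ k l] crispD[OF crisp_Eql, of _ l k]
    by (metis bot_neq_top inf_top.left_neutral inf_top.right_neutral order_bot_class.bot_least top_greatest tval.simps(4,8) uminus_bot)
qed (simp add: sem_le_refl)

lemma Eql_sym: "Eql k l \<simeq> Eql l k"
  by (intro sem_eqI Eql_sym_le)

lemma Exists_Eql_left: "k \<noteq> l \<Longrightarrow> k \<noteq> m \<Longrightarrow> Exists k (Conj (Eql k l) (Eql k m)) \<simeq> Eql l m"
  by (rule sem_eq_trans[OF _ Exists_Eql]) (auto intro!: Exists_cong Conj_cong Eql_sym sem_eq_refl)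

lemma Eql_trans: "Conj (Eql j k) (Eql k l) \<preceq> Eql j l"
proof (cases "k = j \<or> k = l")
  case True
  then show ?thesis by (auto simp: sem_le_def)
next
  case False
  then show ?thesis
    using sem_le_eq_trans[OF Exists_increasing Exists_Eql] by metis
qed

lemma Exists_Eql_top: "k \<noteq> l \<Longrightarrow> Exists k (Eql k l) \<simeq> Tv top"
proof -
  assume "k \<noteq> l"
  then have "Eql l l \<simeq> Exists k (Conj (Eql k l) (Eql k l))"
    by (intro sem_eq_sym[OF Exists_Eql_left]) auto
  also have "\<dots> \<simeq> Exists k (Eql k l)" by (rule Exists_cong) (simp add: sem_eq_def)
  finally show ?thesis using Eql_refl unfolding sem_eq_def by (metis tval.simps(3))
qed

lemma Sub_vacuous:
  assumes "k \<noteq> l" "k \<notin> Fv \<theta>"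
  shows "Sub k l \<theta> \<simeq> \<theta>"
proof -
  have "Sub k l \<theta> \<simeq> Conj (Exists k (Eql k l)) \<theta>"
    unfolding Sub_def by (rule Exists_Conj_right) fact
  also have "\<dots> \<simeq> \<theta>"
    using Exists_Eql_top[OF assms(1)] by (auto simp: sem_eq_def)
  finally show ?thesis .
qed

lemma crisp_Sub: "crisp \<theta> \<Longrightarrow> crisp (Sub k l \<theta>)"
  unfolding Sub_def by (intro crisp_Exists crisp_Conj crisp_Eql)

lemma Sub_exclusive:
  assumes "k \<noteq> l" "point v" "\<theta> \<preceq> Neg (Gam top \<phi>)"
  shows "\<not> (tval (Sub k l \<theta>) v = top \<and> tval (Sub k l (Gam top \<phi>)) v = top)"
  using Sub_Gam_top_contradictory[OF assms(1,2), of \<phi>] Sub_mono[OF assms(3), of k l] assms(2)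
  unfolding sem_le_def by (metis bot_neq_top inf_top.right_neutral top.extremum_uniqueI)

text \<open>The disjunction \<open>?D\<close> of all the \<open>S\<^sup>k\<^sub>l \<gamma>\<^sub>q \<theta>\<close> lies above \<open>v\<^sub>k \<approx> v\<^sub>l\<close>, since at a point \<open>\<theta>\<close> has some value
  \<open>q\<close>, and \<open>v\<^sub>k\<close> is not free in it.  So it lies above \<open>\<exists>v\<^sub>k v\<^sub>k \<approx> v\<^sub>l\<close>, which is true.\<close>

lemma Sub_Gam_exists:
  assumes "k \<noteq> l" "point v"
  shows "\<exists>q. tval (Sub k l (Gam q \<theta>)) v = top"
proof -
  let ?D = "BigDisj UNIV (\<lambda>q. Sub k l (Gam q \<theta>))"
  have D: "tval ?D w = (if \<exists>q. tval (Sub k l (Gam q \<theta>)) w = top then top else bot)"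
    if "point w" for w
    using crisp_Sub[OF crisp_Gam] that unfolding crisp_def by (subst tval_BigDisj) auto
  have "Eql k l \<preceq> ?D"
    unfolding sem_le_def
  proof (intro allI impI)
    fix w assume w: "point w"
    have "Conj (Eql k l) (Gam (tval \<theta> w) \<theta>) \<preceq> Sub k l (Gam (tval \<theta> w) \<theta>)"
      unfolding Sub_def by (rule Exists_increasing)
    then have "tval (Eql k l) w \<le> tval (Sub k l (Gam (tval \<theta> w) \<theta>)) w"
      using w unfolding sem_le_def by auto
    moreover have "tval (Sub k l (Gam (tval \<theta> w) \<theta>)) w \<le> tval ?D w"
      by (rule crispE[OF crisp_Sub[OF crisp_Gam] w, of k l "tval \<theta> w" \<theta>]) (auto simp: D[OF w])
    ultimately show "tval (Eql k l) w \<le> tval ?D w" by (rule order_trans)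
  qed
  then have "Exists k (Eql k l) \<preceq> ?D"
    by (rule Exists_least) (use assms(1) in \<open>auto simp: Fv_BigDisj Sub_def\<close>)
  then have "tval ?D v = top"
    using Exists_Eql_top[OF assms(1)] assms(2) unfolding sem_le_def sem_eq_def
    by (metis top.extremum_uniqueI tval.simps(3))
  then show ?thesis using D[OF assms(2)] by (metis bot_neq_top)
qed

lemma Sub_Gam_unique:
  assumes "k \<noteq> l" "point v" "tval (Sub k l (Gam p \<theta>)) v = top" "tval (Sub k l (Gam q \<theta>)) v = top"
  shows "p = q"
proof (rule ccontr)
  assume "p \<noteq> q"
  then have "Gam p \<theta> \<preceq> Neg (Gam top (Gam q \<theta>))"
    by (auto simp: sem_le_def bot_top_simps)
  moreover have "tval (Sub k l (Gam top (Gam q \<theta>))) v = top"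
    using Sub_cong[OF crisp_Gam_top[OF crisp_Gam]] assms(2,4) unfolding sem_eq_def by metis
  ultimately show False using Sub_exclusive assms(1-3) by blast
qed

text \<open>Substitution commutes with \<open>\<gamma>\<^sub>q\<close>.  Let \<open>r\<close> be the unique value for which \<open>S\<^sup>k\<^sub>l \<gamma>\<^sub>r \<theta>\<close> holds.  The value of
  \<open>S\<^sup>k\<^sub>l \<theta>\<close> is the supremum of the set \<open>?B\<close> of values that \<open>v\<^sub>k \<approx> v\<^sub>l \<and> \<theta>\<close> attains as \<open>v\<^sub>k\<close> varies.  Away
  from \<open>v\<^sub>l\<close> this conjunction has value \<open>bot\<close>, which does not affect the supremum, so it is \<open>r\<close>.\<close>

lemma tval_Sub_Gam:
  assumes "k \<noteq> l" "point v"
  shows "tval (Sub k l (Gam q \<theta>)) v = (if tval (Sub k l \<theta>) v = q then top else bot)"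
proof -
  obtain r where r: "tval (Sub k l (Gam r \<theta>)) v = top" using Sub_Gam_exists[OF assms] by blast
  let ?B = "{q. tval (Exists k (Gam q (Conj (Eql k l) \<theta>))) v = top}"
  \<comment> \<open>The value \<open>bot\<close> is set aside: whether it belongs to \<open>?B\<close> also depends on \<open>v\<^sub>k\<close> away from \<open>v\<^sub>l\<close>.\<close>
  have B: "q \<in> ?B \<longleftrightarrow> q = r" if "q \<noteq> bot" for q
  proof -
    have "Gam q (Conj (Eql k l) \<theta>) \<simeq> Conj (Eql k l) (Gam q \<theta>)"
      unfolding sem_eq_def
    proof (intro allI impI)
      fix w assume w: "point w"
      show "tval (Gam q (Conj (Eql k l) \<theta>)) w = tval (Conj (Eql k l) (Gam q \<theta>)) w"
        by (rule crispE[OF crisp_Eql[of k l] w]) (use that in auto)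
    qed
    then have "Exists k (Gam q (Conj (Eql k l) \<theta>)) \<simeq> Sub k l (Gam q \<theta>)"
      unfolding Sub_def by (rule Exists_cong)
    then have *: "q \<in> ?B \<longleftrightarrow> tval (Sub k l (Gam q \<theta>)) v = top"
      using assms(2) by (simp only: sem_eq_def mem_Collect_eq)
    show ?thesis
      unfolding * using r Sub_Gam_unique[OF assms r, of q] by metis
  qed
  have B_ne: "?B \<noteq> {}" using tval_Exists(1)[OF assms(2)] .
  have "Sup_fin ?B = r"
  proof (rule order_antisym)
    show "Sup_fin ?B \<le> r"
    proof (rule Sup_fin.boundedI)
      fix q assume "q \<in> ?B"
      then show "q \<le> r" using B[of q] by (cases "q = bot") auto
    qed (use B_ne in auto)
    show "r \<le> Sup_fin ?B"
    proof (cases "r = bot")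
      case False
      then have "r \<in> ?B" using B by blast
      then show ?thesis by (intro Sup_fin.coboundedI) auto
    qed simp
  qed
  then have "tval (Sub k l \<theta>) v = r"
    using tval_Exists(2)[OF assms(2), of k "Conj (Eql k l) \<theta>"] unfolding Sub_def by simp
  then show ?thesis
    using r Sub_Gam_unique[OF assms r] crispD[OF crisp_Sub[OF crisp_Gam] assms(2)] by metis
qed

lemma Sub_Neg_crisp:
  assumes "k \<noteq> l" "point v" "crisp \<theta>"
  shows "tval (Sub k l (Neg \<theta>)) v = - tval (Sub k l \<theta>) v"
proof -
  have "Neg \<theta> \<simeq> Gam bot \<theta>"
    using assms(3) by (auto simp: sem_eq_def bot_top_simps elim: crispE)
  then have "tval (Sub k l (Neg \<theta>)) v = tval (Sub k l (Gam bot \<theta>)) v"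
    using Sub_cong assms(2) unfolding sem_eq_def by blast
  then have *: "tval (Sub k l (Neg \<theta>)) v = (if tval (Sub k l \<theta>) v = bot then top else bot)"
    by (simp only: tval_Sub_Gam[OF assms(1,2)])
  show ?thesis
    unfolding *
    by (rule crispE[OF crisp_Sub[OF assms(3)] assms(2), of k l]) (simp_all add: bot_top_simps)
qed

text \<open>Substitution is additive by the \<open>\<exists>\<close>-rule and commutes with negation, hence it also respects
  conjunctions of crisp formulas.\<close>

lemma Sub_Conj_crisp_top:
  assumes "k \<noteq> l" "point v" "crisp \<theta>" "crisp \<phi>"
    and "tval (Sub k l \<theta>) v = top" "tval (Sub k l \<phi>) v = top"
  shows "tval (Sub k l (Conj \<theta> \<phi>)) v = top"
proof (rule ccontr)
  let ?N = "Neg (Conj \<theta> \<phi>)"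
  assume "tval (Sub k l (Conj \<theta> \<phi>)) v \<noteq> top"
  then have N: "tval (Sub k l ?N) v = top"
    using Sub_Neg_crisp[OF assms(1,2) crisp_Conj[OF assms(3,4)]]
      crispD[OF crisp_Sub[OF crisp_Conj[OF assms(3,4)]] assms(2)] by (metis uminus_bot)
  have "Conj (Eql k l) ?N \<preceq> Disj (Sub k l (Neg \<theta>)) (Sub k l (Neg \<phi>))"
  proof -
    have "Conj (Eql k l) (Neg \<theta>) \<preceq> Sub k l (Neg \<theta>)" "Conj (Eql k l) (Neg \<phi>) \<preceq> Sub k l (Neg \<phi>)"
      unfolding Sub_def by (rule Exists_increasing)+
    then show ?thesis
      unfolding sem_le_def by (auto simp: uminus_inf inf_sup_distrib1 intro: le_supI1 le_supI2)
  qed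
  then have "Sub k l ?N \<preceq> Disj (Sub k l (Neg \<theta>)) (Sub k l (Neg \<phi>))"
    unfolding Sub_def[of k l ?N]
    by (rule Exists_least) (use assms(1) in \<open>auto simp: Sub_def\<close>)
  then have "top \<le> sup (tval (Sub k l (Neg \<theta>)) v) (tval (Sub k l (Neg \<phi>)) v)"
    using N assms(2) unfolding sem_le_def by (metis tval.simps(6))
  then show False
    using assms(5,6) Sub_Neg_crisp[OF assms(1,2,3)] Sub_Neg_crisp[OF assms(1,2,4)]
    by (simp add: bot_top_simps top_unique)
qed

lemma tval_Sub_of_value:
  "k \<noteq> l \<Longrightarrow> point v \<Longrightarrow> tval (Sub k l (Gam q \<theta>)) v = top \<Longrightarrow> tval (Sub k l \<theta>) v = q"
  using tval_Sub_Gam by (metis bot_neq_top)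

lemma tval_Sub_Gam_value:
  "k \<noteq> l \<Longrightarrow> point v \<Longrightarrow> tval (Sub k l (Gam (tval (Sub k l \<theta>) v) \<theta>)) v = top"
  by (simp add: tval_Sub_Gam)

text \<open>The passage from crisp formulas to \<open>M\<close>-valued ones: if the values of \<open>\<theta>\<close> and \<open>\<phi>\<close> determine that of \<open>\<psi>\<close>,
  then the same dependence holds between the values after substitution.  The laws for the binary
  connectives and, with \<open>\<theta>\<close> repeated, for negation are instances.\<close>

lemma tval_Sub_from_values:
  assumes "k \<noteq> l" "point v"
    and "Conj (Gam (tval (Sub k l \<theta>) v) \<theta>) (Gam (tval (Sub k l \<phi>) v) \<phi>) \<preceq> Gam r \<psi>"
  shows "tval (Sub k l \<psi>) v = r"
proof -
  have "tval (Sub k l (Conj (Gam (tval (Sub k l \<theta>) v) \<theta>) (Gam (tval (Sub k l \<phi>) v) \<phi>))) v = top"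
    by (intro Sub_Conj_crisp_top assms(1,2) crisp_Gam tval_Sub_Gam_value)
  then have "tval (Sub k l (Gam r \<psi>)) v = top"
    using Sub_mono[OF assms(3), of k l] assms(2) unfolding sem_le_def by (metis top.extremum_uniqueI)
  then show ?thesis using tval_Sub_of_value assms(1,2) by blast
qed

lemma Sub_Conj: "k \<noteq> l \<Longrightarrow> Sub k l (Conj \<theta> \<phi>) \<simeq> Conj (Sub k l \<theta>) (Sub k l \<phi>)"
  unfolding sem_eq_def
  by (intro allI impI, rule tval_Sub_from_values[of _ _ _ \<theta> \<phi>]) (auto simp: sem_le_def)

lemma Sub_Disj: "k \<noteq> l \<Longrightarrow> Sub k l (Disj \<theta> \<phi>) \<simeq> Disj (Sub k l \<theta>) (Sub k l \<phi>)"
  unfolding sem_eq_def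
  by (intro allI impI, rule tval_Sub_from_values[of _ _ _ \<theta> \<phi>]) (auto simp: sem_le_def)

lemma Sub_Neg: "k \<noteq> l \<Longrightarrow> Sub k l (Neg \<theta>) \<simeq> Neg (Sub k l \<theta>)"
  unfolding sem_eq_def
  by (intro allI impI, rule tval_Sub_from_values[of _ _ _ \<theta> \<theta>]) (auto simp: sem_le_def)

lemma Sub_Gam: "k \<noteq> l \<Longrightarrow> Sub k l (Gam p \<theta>) \<simeq> Gam p (Sub k l \<theta>)"
  unfolding sem_eq_def by (simp add: tval_Sub_Gam)

lemma Sub_Tv: "k \<noteq> l \<Longrightarrow> Sub k l (Tv p) \<simeq> Tv p"
  by (simp add: Sub_vacuous)

lemma Sub_Exists:
  assumes "n \<notin> {k, l}"
  shows "Sub k l (Exists n \<theta>) \<simeq> Exists n (Sub k l \<theta>)"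
proof -
  have "Sub k l (Exists n \<theta>) \<simeq> Exists k (Exists n (Conj (Eql k l) \<theta>))"
    unfolding Sub_def by (intro Exists_cong sem_eq_sym[OF Exists_Conj_left]) (use assms in auto)
  also have "\<dots> \<simeq> Exists n (Sub k l \<theta>)" unfolding Sub_def by (rule Exists_commute)
  finally show ?thesis .
qed

text \<open>Renaming a bound variable, by interchanging the two quantifiers in
  \<open>\<exists>v\<^sub>n\<^sub>' \<exists>v\<^sub>n (v\<^sub>n \<approx> v\<^sub>n\<^sub>' \<and> \<theta>)\<close>.\<close>

lemma Exists_rename:
  assumes "n' \<notin> Fv \<theta>" "n \<noteq> n'"
  shows "Exists n' (Sub n n' \<theta>) \<simeq> Exists n \<theta>"
proof -
  have "Exists n' (Sub n n' \<theta>) \<simeq> Exists n (Exists n' (Conj (Eql n n') \<theta>))"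
    unfolding Sub_def by (rule Exists_commute)
  also have "\<dots> \<simeq> Exists n (Conj (Exists n' (Eql n n')) \<theta>)"
    by (intro Exists_cong Exists_Conj_right assms)
  also have "\<dots> \<simeq> Exists n \<theta>"
  proof (rule Exists_cong)
    have "Exists n' (Eql n n') \<simeq> Tv top"
      using Exists_cong[OF Eql_sym] Exists_Eql_top assms(2) by (metis sem_eq_trans)
    then show "Conj (Exists n' (Eql n n')) \<theta> \<simeq> \<theta>" by (auto simp: sem_eq_def)
  qed
  finally show ?thesis .
qed

lemma Sub_Eql:
  assumes "k \<noteq> l"
  shows "Sub k l (Eql a b) \<simeq> Eql (repl k l a) (repl k l b)"
proof -
  have *: "Sub k l (Eql k b) \<simeq> Eql l b" if "k \<noteq> b" for b
    unfolding Sub_def using assms that by (rule Exists_Eql_left)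
  consider "a \<noteq> k" "b \<noteq> k" | "a = k" "b = k" | "a = k" "b \<noteq> k" | "a \<noteq> k" "b = k" by blast
  then show ?thesis
  proof cases
    case 1
    then show ?thesis using assms by (auto intro: Sub_vacuous)
  next
    case 2
    have "Sub k l (Eql k k) \<simeq> Sub k l (Tv top)"
      by (intro Sub_cong sem_eq_axiom is_axiom.intros)
    also have "\<dots> \<simeq> Tv top" by (rule Sub_Tv[OF assms])
    also have "\<dots> \<simeq> Eql l l" by (intro sem_eq_sym[OF sem_eq_axiom] is_axiom.intros)
    finally show ?thesis using 2 by simp
  next
    case 3
    then show ?thesis using * by simp
  next
    case 4
    then have "Sub k l (Eql a k) \<simeq> Eql l a"
      using Sub_cong[OF Eql_sym] * by (metis sem_eq_trans)
    then show ?thesis using 4 Eql_sym by (auto intro: sem_eq_trans)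
  qed
qed

lemma Sub_Sub:
  assumes "a \<notin> {k, l, b}" "k \<noteq> l"
  shows "Sub k l (Sub a b \<theta>) \<simeq> Sub a (repl k l b) (Sub k l \<theta>)"
proof -
  have "Sub k l (Sub a b \<theta>) \<simeq> Exists a (Sub k l (Conj (Eql a b) \<theta>))"
    unfolding Sub_def[of a b] by (rule Sub_Exists) (use assms in auto)
  also have "\<dots> \<simeq> Exists a (Conj (Sub k l (Eql a b)) (Sub k l \<theta>))"
    by (intro Exists_cong Sub_Conj assms)
  also have "\<dots> \<simeq> Sub a (repl k l b) (Sub k l \<theta>)"
    unfolding Sub_def[of a "repl k l b"]
    using Sub_Eql[OF assms(2), of a b] assms(1)
    by (intro Exists_cong Conj_cong sem_eq_refl) simp
  finally show ?thesis .
qed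

lemma Sub_Subs:
  assumes "k \<noteq> l" "length ks = length js" "set ks \<inter> ({k, l} \<union> set js) = {}"
  shows "Sub k l (foldr (\<lambda>(k, j). Sub k j) (zip ks js) \<theta>)
    \<simeq> foldr (\<lambda>(k, j). Sub k j) (zip ks (map (repl k l) js)) (Sub k l \<theta>)"
  using assms(2,3)
proof (induction ks js rule: list_induct2)
  case Nil
  then show ?case by (simp add: sem_eq_refl)
next
  case (Cons a ks b js)
  let ?S = "foldr (\<lambda>(k, j). Sub k j) (zip ks js) \<theta>"
  have "Sub k l (Sub a b ?S) \<simeq> Sub a (repl k l b) (Sub k l ?S)"
    by (rule Sub_Sub) (use Cons.prems assms(1) in auto)
  also have "\<dots> \<simeq> Sub a (repl k l b)
      (foldr (\<lambda>(k, j). Sub k j) (zip ks (map (repl k l) js)) (Sub k l \<theta>))"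
    by (rule Sub_cong[OF Cons.IH]) (use Cons.prems in auto)
  finally show ?case by simp
qed

lemma Subs_cong:
  "\<theta> \<simeq> \<phi> \<Longrightarrow> foldr (\<lambda>(k, j). Sub k j) zs \<theta> \<simeq> foldr (\<lambda>(k, j). Sub k j) zs \<phi>"
  by (induction zs) (auto intro: Sub_cong)

lemma Fv_Subs_subset:
  assumes "length ms = length ks" "set ms \<inter> set ks = {}"
  shows "Fv (foldr (\<lambda>(m, k). Sub m k) (zip ms ks) \<theta>) \<subseteq> set ks \<union> (Fv \<theta> - set ms)"
  using assms by (induction ms ks rule: list_induct2) (auto simp: Sub_def)

text \<open>By the axiom for atoms, \<open>R\<^sub>i v\<^sub>j\<^sub>0 \<dots>\<close> arises from one and the same formula \<open>?R\<close>, an atom in fresh variables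
  \<open>ks\<close>, by substituting the \<open>js\<close> for the \<open>ks\<close>.  A further substitution of \<open>v\<^sub>l\<close> for \<open>v\<^sub>k\<close> passes through the
  outer substitutions, changing only their targets, and leaves \<open>?R\<close> alone because \<open>v\<^sub>k\<close> is not free
  in it.\<close>

lemma Sub_Rel:
  assumes "k \<noteq> l"
  shows "Sub k l (Rel i js) \<simeq> Rel i (map (repl k l) js)"
proof (cases "length js = ar i")
  case False
  have bot: "Rel i ls \<simeq> Tv bot" if "length ls \<noteq> ar i" for ls
    using point_top[OF _ derivable.wrong_arity[of ls ar i \<Sigma>, OF that]]
    unfolding sem_eq_def tval_Equiv_eq_top by blast
  have "Sub k l (Rel i js) \<simeq> Sub k l (Tv bot)" by (intro Sub_cong bot False)
  also have "\<dots> \<simeq> Tv bot" by (rule Sub_Tv[OF assms])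
  also have "\<dots> \<simeq> Rel i (map (repl k l) js)" using False by (intro sem_eq_sym[OF bot]) simp
  finally show ?thesis .
next
  case True
  \<comment> \<open>One block \<open>ks\<close> of variables serves for \<open>js\<close> and for the list obtained by the substitution.\<close>
  define N where "N = Suc (Max (insert (ar i) ({k, l} \<union> set js)))"
  define ks where "ks = [N..<N + ar i]"
  have N: "x < N" if "x \<in> insert (ar i) ({k, l} \<union> set js)" for x
    unfolding N_def using that by (meson List.finite_set Max_ge finite.emptyI finite_UnI finite_insert le_imp_less_Suc)
  have ks: "length ks = ar i" "distinct ks" unfolding ks_def by auto
  have fresh: "set ks \<inter> ({0..<ar i} \<union> ({k, l} \<union> set js)) = {}"
    using N unfolding ks_def by fastforce
  let ?R = "foldr (\<lambda>(m, k). Sub m k) (zip [0..<ar i] ks) (Rel i [0..<ar i])"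
  have R: "Rel i ls \<simeq> foldr (\<lambda>(k, j). Sub k j) (zip ks ls) ?R"
    if "length ls = ar i" "set ls \<subseteq> {k, l} \<union> set js" for ls
    by (intro sem_eq_axiom is_axiom.Rel_Sub) (use that ks fresh in auto)
  have "k \<notin> Fv ?R"
    using Fv_Subs_subset[of "[0..<ar i]" ks "Rel i [0..<ar i]"] ks fresh by auto
  then have vac: "Sub k l ?R \<simeq> ?R" by (rule Sub_vacuous[OF assms])
  have "Sub k l (Rel i js) \<simeq> Sub k l (foldr (\<lambda>(k, j). Sub k j) (zip ks js) ?R)"
    by (intro Sub_cong R True) auto
  also have "\<dots> \<simeq> foldr (\<lambda>(k, j). Sub k j) (zip ks (map (repl k l) js)) (Sub k l ?R)"
    by (rule Sub_Subs) (use assms True ks fresh in auto)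
  also have "\<dots> \<simeq> foldr (\<lambda>(k, j). Sub k j) (zip ks (map (repl k l) js)) ?R"
    by (rule Subs_cong[OF vac])
  also have "\<dots> \<simeq> Rel i (map (repl k l) js)"
    by (rule sem_eq_sym[OF R]) (use True in \<open>auto simp: repl_def\<close>)
  finally show ?thesis .
qed

lemma derivable_Sub:
  assumes "derivable ar \<Sigma> \<theta>" "k \<noteq> l" "point v"
  shows "tval (Sub k l \<theta>) v = top"
proof -
  have "\<theta> \<simeq> Tv top" using assms(1) by (simp add: sem_eq_def point_top)
  then have "Sub k l \<theta> \<simeq> Tv top" using Sub_cong Sub_Tv[OF assms(2)] by (metis sem_eq_trans)
  then show ?thesis using assms(3) by (simp add: sem_eq_def)
qed

section \<open>Derivability and simultaneous substitution\<close>

text \<open>Stated relative to the substitution law for \<open>\<theta>\<close>, since it is needed inside the inductive proof of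
  that law.\<close>

lemma Exists_sub_rename:
  assumes Sub_sub: "\<And>\<tau> m l. m \<noteq> l \<Longrightarrow> Sub m l (sub \<theta> \<tau>) \<simeq> sub \<theta> (repl m l \<circ> \<tau>)"
    and "n \<notin> \<tau> ` (Fv \<theta> - {k})" "n' \<notin> \<tau> ` (Fv \<theta> - {k})"
  shows "Exists n (sub \<theta> (\<tau>(k := n))) \<simeq> Exists n' (sub \<theta> (\<tau>(k := n')))"
proof (cases "n = n'")
  case False
  have "n' \<notin> Fv (sub \<theta> (\<tau>(k := n)))"
    using assms(3) False by (auto simp: Fv_sub)
  then have "Exists n (sub \<theta> (\<tau>(k := n))) \<simeq> Exists n' (Sub n n' (sub \<theta> (\<tau>(k := n))))"
    using False by (intro sem_eq_sym[OF Exists_rename]) auto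
  also have "\<dots> \<simeq> Exists n' (sub \<theta> (repl n n' \<circ> \<tau>(k := n)))"
    by (intro Exists_cong Sub_sub False)
  also have "sub \<theta> (repl n n' \<circ> \<tau>(k := n)) = sub \<theta> (\<tau>(k := n'))"
    by (rule sub_cong) (use assms(2) in \<open>auto simp: repl_def\<close>)
  finally show ?thesis .
qed (simp add: sem_eq_refl)

text \<open>The operator \<open>S\<^sup>m\<^sub>l\<close> of the axioms is ordinary substitution.  The only case with content is the
  quantifier, where the bound variable is first renamed to one that avoids \<open>m\<close>, \<open>l\<close> and the free
  variables on both sides.\<close>

lemma Sub_sub: "m \<noteq> l \<Longrightarrow> Sub m l (sub \<theta> \<tau>) \<simeq> sub \<theta> (repl m l \<circ> \<tau>)"
proof (induction \<theta> arbitrary: \<tau> m l)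
  case (Rel i ks)
  then show ?case using Sub_Rel[of m l i "map \<tau> ks"] by (simp add: comp_def)
next
  case (Eql j k)
  then show ?case using Sub_Eql[of m l "\<tau> j" "\<tau> k"] by simp
next
  case (Tv p)
  then show ?case using Sub_Tv by simp
next
  case (Neg \<theta>)
  have "Sub m l (Neg (sub \<theta> \<tau>)) \<simeq> Neg (Sub m l (sub \<theta> \<tau>))" by (intro Sub_Neg Neg.prems)
  then show ?case using Neg.IH[OF Neg.prems] unfolding sem_eq_def by simp
next
  case (Conj \<theta>1 \<theta>2)
  have "Sub m l (Conj (sub \<theta>1 \<tau>) (sub \<theta>2 \<tau>)) \<simeq> Conj (Sub m l (sub \<theta>1 \<tau>)) (Sub m l (sub \<theta>2 \<tau>))"
    by (intro Sub_Conj Conj.prems)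
  then show ?case
    using Conj.IH(1)[OF Conj.prems, of \<tau>] Conj.IH(2)[OF Conj.prems, of \<tau>]
    unfolding sem_eq_def by simp
next
  case (Disj \<theta>1 \<theta>2)
  have "Sub m l (Disj (sub \<theta>1 \<tau>) (sub \<theta>2 \<tau>)) \<simeq> Disj (Sub m l (sub \<theta>1 \<tau>)) (Sub m l (sub \<theta>2 \<tau>))"
    by (intro Sub_Disj Disj.prems)
  then show ?case
    using Disj.IH(1)[OF Disj.prems, of \<tau>] Disj.IH(2)[OF Disj.prems, of \<tau>]
    unfolding sem_eq_def by simp
next
  case (Gam p \<theta>)
  have "Sub m l (Gam p (sub \<theta> \<tau>)) \<simeq> Gam p (Sub m l (sub \<theta> \<tau>))" by (intro Sub_Gam Gam.prems)
  then show ?case using Gam.IH[OF Gam.prems] unfolding sem_eq_def by simp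
next
  case (Exists k \<theta>)
  note rename = Exists_sub_rename[OF Exists.IH]
  let ?\<rho> = "repl m l \<circ> \<tau>"
  let ?F = "\<tau> ` (Fv \<theta> - {k})" and ?F' = "?\<rho> ` (Fv \<theta> - {k})"
  define n where "n = fresh (insert m (insert l (?F \<union> ?F')))"
  have "n \<notin> insert m (insert l (?F \<union> ?F'))"
    unfolding n_def by (intro fresh) (simp add: finite_Fv)
  then have n: "n \<notin> {m, l}" "n \<notin> ?F" "n \<notin> ?F'" by auto
  have "sub (Exists k \<theta>) \<tau> \<simeq> Exists n (sub \<theta> (\<tau>(k := n)))"
    unfolding sub.simps Let_def by (intro rename n fresh) (simp_all add: finite_Fv)
  then have "Sub m l (sub (Exists k \<theta>) \<tau>) \<simeq> Sub m l (Exists n (sub \<theta> (\<tau>(k := n))))"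
    by (rule Sub_cong)
  also have "\<dots> \<simeq> Exists n (Sub m l (sub \<theta> (\<tau>(k := n))))" by (intro Sub_Exists n)
  also have "\<dots> \<simeq> Exists n (sub \<theta> (repl m l \<circ> \<tau>(k := n)))"
    by (intro Exists_cong Exists.IH Exists.prems)
  also have "repl m l \<circ> \<tau>(k := n) = ?\<rho>(k := n)"
    using n(1) by (auto simp: fun_eq_iff)
  also have "Exists n (sub \<theta> (?\<rho>(k := n))) \<simeq> sub (Exists k \<theta>) ?\<rho>"
    unfolding sub.simps Let_def by (intro rename n fresh) (simp_all add: finite_Fv)
  finally show ?case .
qed

lemma sub_Exists:
  assumes "n \<notin> \<tau> ` (Fv \<theta> - {k})"
  shows "sub (Exists k \<theta>) \<tau> \<simeq> Exists n (sub \<theta> (\<tau>(k := n)))"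
  unfolding sub.simps Let_def
  by (intro Exists_sub_rename Sub_sub assms fresh) (simp_all add: finite_Fv)

lemma sub_id: "sub \<theta> id \<simeq> \<theta>"
proof (induction \<theta>)
  case (Exists k \<theta>)
  have "sub (Exists k \<theta>) id \<simeq> Exists k (sub \<theta> (id(k := k)))"
    by (rule sub_Exists) simp
  also have "id(k := k) = id" by auto
  also have "Exists k (sub \<theta> id) \<simeq> Exists k \<theta>" by (rule Exists_cong[OF Exists.IH])
  finally show ?case .
qed (auto simp: sem_eq_def)

lemma derivable_of_sem_eq:
  assumes "derivable ar \<Sigma> \<theta>" "\<theta> \<simeq> \<phi>"
  shows "derivable ar \<Sigma> \<phi>"
proof (rule derivable_if_top_at_points)
  fix v assume "point v"
  then show "tval \<phi> v = top"
    using point_top[OF _ assms(1)] assms(2) unfolding sem_eq_def by metis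
qed

text \<open>Any simultaneous substitution is, on the finitely many free variables, a composition of single
  ones: first all free variables are moved beyond \<open>N\<close>, one at a time, and then each is moved to its
  target.  The detour prevents a variable that has already been moved from being moved again.\<close>

lemma derivable_sub:
  assumes "derivable ar \<Sigma> \<theta>"
  shows "derivable ar \<Sigma> (sub \<theta> \<tau>)"
proof -
  have step: "derivable ar \<Sigma> (sub \<theta> (repl m l \<circ> \<rho>))"
    if "derivable ar \<Sigma> (sub \<theta> \<rho>)" "m \<noteq> l" for \<rho> m l
    by (rule derivable_of_sem_eq[OF _ Sub_sub[OF that(2)]])
      (intro derivable_if_top_at_points derivable_Sub that)
  define N where "N = Suc (Max (insert 0 (Fv \<theta> \<union> \<tau> ` Fv \<theta>)))"
  have N: "j < N" if "j \<in> Fv \<theta> \<union> \<tau> ` Fv \<theta>" for j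
    unfolding N_def using that finite_Fv by (intro le_imp_less_Suc Max_ge) auto
  have away: "derivable ar \<Sigma> (sub \<theta> (\<lambda>j. if j \<in> F then j + N else j))"
    if "finite F" "F \<subseteq> Fv \<theta>" for F
    using that
  proof induction
    case empty
    have "sub \<theta> (\<lambda>j. j) \<simeq> \<theta>" using sub_id by (simp add: id_def)
    then show ?case using assms derivable_of_sem_eq[OF _ sem_eq_sym] by simp
  next
    case (insert k F)
    have "derivable ar \<Sigma> (sub \<theta> (repl k (k + N) \<circ> (\<lambda>j. if j \<in> F then j + N else j)))"
      using insert N[of k] by (intro step) auto
    also have "sub \<theta> (repl k (k + N) \<circ> (\<lambda>j. if j \<in> F then j + N else j))
        = sub \<theta> (\<lambda>j. if j \<in> insert k F then j + N else j)"
      using insert.hyps insert.prems N[of k] by (intro sub_cong) (auto simp: repl_def)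
    finally show ?case .
  qed
  have onto: "derivable ar \<Sigma> (sub \<theta> (\<lambda>j. if j \<in> F then \<tau> j else j + N))"
    if "finite F" "F \<subseteq> Fv \<theta>" for F
    using that
  proof induction
    case empty
    have "derivable ar \<Sigma> (sub \<theta> (\<lambda>j. if j \<in> Fv \<theta> then j + N else j))"
      by (intro away finite_Fv) simp
    also have "sub \<theta> (\<lambda>j. if j \<in> Fv \<theta> then j + N else j) = sub \<theta> (\<lambda>j. j + N)"
      by (rule sub_cong) simp
    finally show ?case by simp
  next
    case (insert k F)
    have "derivable ar \<Sigma> (sub \<theta> (repl (k + N) (\<tau> k) \<circ> (\<lambda>j. if j \<in> F then \<tau> j else j + N)))"
      using insert N[of "\<tau> k"] by (intro step) auto
    also have "sub \<theta> (repl (k + N) (\<tau> k) \<circ> (\<lambda>j. if j \<in> F then \<tau> j else j + N))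
        = sub \<theta> (\<lambda>j. if j \<in> insert k F then \<tau> j else j + N)"
    proof (rule sub_cong)
      fix j assume j: "j \<in> Fv \<theta>"
      then have "\<tau> j < N" using N by simp
      then show "(repl (k + N) (\<tau> k) \<circ> (\<lambda>j. if j \<in> F then \<tau> j else j + N)) j
          = (if j \<in> insert k F then \<tau> j else j + N)"
        using insert.hyps(2) by (auto simp: repl_def)
    qed
    finally show ?case .
  qed
  have "derivable ar \<Sigma> (sub \<theta> (\<lambda>j. if j \<in> Fv \<theta> then \<tau> j else j + N))"
    by (intro onto finite_Fv) simp
  also have "sub \<theta> (\<lambda>j. if j \<in> Fv \<theta> then \<tau> j else j + N) = sub \<theta> \<tau>"
    by (rule sub_cong) simp
  finally show ?thesis .
qed

lemma Sub_Eql_le: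
  assumes "point v" "tval (Eql x y) v = top" "m \<notin> {x, y}"
  shows "tval (Sub m x \<theta>) v \<le> tval (Sub m y \<theta>) v"
proof -
  have "Conj (Sub m x \<theta>) (Eql x y) \<simeq> Exists m (Conj (Conj (Eql m x) \<theta>) (Eql x y))"
    unfolding Sub_def using assms(3) by (intro sem_eq_sym[OF Exists_Conj_right]) auto
  also have "\<dots> \<preceq> Sub m y \<theta>"
    unfolding Sub_def
  proof (rule Exists_mono)
    have "Conj (Eql m x) (Eql x y) \<preceq> Eql m y" by (rule Eql_trans)
    then show "Conj (Conj (Eql m x) \<theta>) (Eql x y) \<preceq> Conj (Eql m y) \<theta>"
      unfolding sem_le_def by (auto simp: inf.commute inf.left_commute intro: le_infI2)
  qed
  finally have "inf (tval (Sub m x \<theta>) v) (tval (Eql x y) v) \<le> tval (Sub m y \<theta>) v"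
    using assms(1) unfolding sem_le_def by (metis tval.simps(5))
  then show ?thesis unfolding assms(2) by simp
qed

text \<open>Equality is a congruence.  Variables are exchanged one at a time; a single exchange compares two
  substitutions for a fresh variable \<open>m\<close>.\<close>

lemma tval_sub_Eql:
  assumes "point v" "\<And>j. j \<in> Fv \<theta> \<Longrightarrow> tval (Eql (\<tau> j) (\<rho> j)) v = top"
  shows "tval (sub \<theta> \<tau>) v = tval (sub \<theta> \<rho>) v"
proof -
  have step: "tval (sub \<theta> \<sigma>) v = tval (sub \<theta> (\<sigma>(k := y))) v"
    if eq: "tval (Eql (\<sigma> k) y) v = top" for \<sigma> k y
  proof -
    define m where "m = fresh (insert (\<sigma> k) (insert y (\<sigma> ` Fv \<theta>)))"
    have "m \<notin> insert (\<sigma> k) (insert y (\<sigma> ` Fv \<theta>))"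
      unfolding m_def by (intro fresh) (simp add: finite_Fv)
    then have m: "m \<noteq> \<sigma> k" "m \<noteq> y" "m \<notin> \<sigma> ` Fv \<theta>" by auto
    have *: "tval (Sub m z (sub \<theta> (\<sigma>(k := m)))) v = tval (sub \<theta> (\<sigma>(k := z))) v" if "m \<noteq> z" for z
    proof -
      have "sub \<theta> (repl m z \<circ> \<sigma>(k := m)) = sub \<theta> (\<sigma>(k := z))"
        by (rule sub_cong) (use m(3) in \<open>auto simp: repl_def\<close>)
      then show ?thesis
        using Sub_sub[OF that, of \<theta> "\<sigma>(k := m)"] assms(1) by (auto simp: sem_eq_def)
    qed
    have eq': "tval (Eql y (\<sigma> k)) v = top"
      using eq Eql_sym[of y "\<sigma> k"] assms(1) by (simp only: sem_eq_def)
    show ?thesis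
      using Sub_Eql_le[OF assms(1) eq, of m] Sub_Eql_le[OF assms(1) eq', of m] m *[of "\<sigma> k"] *[of y]
      by (metis fun_upd_triv insert_iff order_antisym singletonD)
  qed
  have "tval (sub \<theta> \<tau>) v = tval (sub \<theta> (\<lambda>j. if j \<in> F then \<rho> j else \<tau> j)) v"
    if "finite F" "F \<subseteq> Fv \<theta>" for F
    using that
  proof induction
    case (insert k F)
    let ?\<sigma> = "\<lambda>j. if j \<in> F then \<rho> j else \<tau> j"
    have "tval (sub \<theta> ?\<sigma>) v = tval (sub \<theta> (?\<sigma>(k := \<rho> k))) v"
      by (rule step) (use insert assms(2) in auto)
    also have "?\<sigma>(k := \<rho> k) = (\<lambda>j. if j \<in> insert k F then \<rho> j else \<tau> j)" by auto
    finally show ?case using insert by simp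
  qed simp
  from this[OF finite_Fv subset_refl]
  have "tval (sub \<theta> \<tau>) v = tval (sub \<theta> (\<lambda>j. if j \<in> Fv \<theta> then \<rho> j else \<tau> j)) v" .
  also have "sub \<theta> (\<lambda>j. if j \<in> Fv \<theta> then \<rho> j else \<tau> j) = sub \<theta> \<rho>"
    by (rule sub_cong) simp
  finally show ?thesis .
qed

lemma tval_sub_le_Exists:
  assumes "point v"
  shows "tval (sub \<theta> (\<tau>(k := l))) v \<le> tval (sub (Exists k \<theta>) \<tau>) v"
proof -
  define m where "m = fresh (insert l (\<tau> ` (Fv \<theta> - {k})))"
  have "m \<notin> insert l (\<tau> ` (Fv \<theta> - {k}))"
    unfolding m_def by (intro fresh) (simp add: finite_Fv)
  then have m: "m \<noteq> l" "m \<notin> \<tau> ` (Fv \<theta> - {k})" by auto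
  have "sub \<theta> (\<tau>(k := l)) = sub \<theta> (repl m l \<circ> \<tau>(k := m))"
    by (rule sub_cong) (use m(2) in \<open>auto simp: repl_def\<close>)
  also have "\<dots> \<simeq> Sub m l (sub \<theta> (\<tau>(k := m)))" by (rule sem_eq_sym[OF Sub_sub[OF m(1)]])
  also have "\<dots> \<preceq> Exists m (sub \<theta> (\<tau>(k := m)))" by (rule Sub_le_Exists)
  also have "\<dots> \<simeq> sub (Exists k \<theta>) \<tau>" by (rule sem_eq_sym[OF sub_Exists[OF m(2)]])
  finally show ?thesis using assms by (simp only: sem_le_def)
qed

end

section \<open>Henkin constants\<close>

text \<open>The base constants name the variables of the formula to be refuted.  The constant \<open>Wit k \<theta> q cs\<close> is
  a witness for the claim that \<open>\<theta>\<close> takes the value \<open>q\<close> for some \<open>v\<^sub>k\<close>, where the other variables denote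
  \<open>cs\<close>.  The witnesses needed for formulas with constants are themselves among the constants, so
  that no iteration over extensions of the language is needed.\<close>

datatype ('i, 'm) con = Base nat | Wit nat "('i, 'm) fm" 'm "('i, 'm) con list"

text \<open>Constants are no more numerous than formulas; this injection spares cardinal arithmetic.\<close>

primrec con_code :: "('i, 'm::de_morgan_algebra) con \<Rightarrow> ('i, 'm) fm" where
  "con_code (Base n) = Eql n n"
| "con_code (Wit k \<theta> q cs) = Conj (Exists k \<theta>) (Conj (Tv q) (foldr Disj (map con_code cs) (Tv bot)))"

lemma foldr_Disj_inject: "foldr Disj xs (Tv p) = foldr Disj ys (Tv p) \<Longrightarrow> xs = ys"
proof (induction xs arbitrary: ys)
  case Nil
  then show ?case by (cases ys) auto
next
  case (Cons x xs)
  then show ?case by (cases ys) auto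
qed

lemma con_code_inject: "con_code c = con_code d \<Longrightarrow> c = d"
proof (induction c arbitrary: d)
  case (Base n)
  then show ?case by (cases d) auto
next
  case (Wit k \<theta> q cs)
  then obtain ds where d: "d = Wit k \<theta> q ds" "map con_code cs = map con_code ds"
    by (cases d) (auto dest: foldr_Disj_inject)
  have "cs = ds" using d(2) Wit.IH by (rule list.inj_map_strong[rotated])
  then show ?case using d by simp
qed

text \<open>The assignment coded by a list of constants; the default value \<open>Base 0\<close> is harmless because lists
  are taken long enough to cover the free variables.\<close>

primrec args :: "('i, 'm) con list \<Rightarrow> nat \<Rightarrow> ('i, 'm) con" where
  "args [] j = Base 0"
| "args (c # cs) j = (case j of 0 \<Rightarrow> c | Suc i \<Rightarrow> args cs i)"

lemma args_in: "args cs j \<in> insert (Base 0) (set cs)"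
  by (induction cs arbitrary: j) (auto split: nat.split)

lemma image_args: "(\<nu> \<circ> args cs) ` A \<subseteq> \<nu> ` insert (Base 0) (set cs)"
proof -
  have "args cs ` A \<subseteq> insert (Base 0) (set cs)" using args_in by (rule image_subsetI)
  then show ?thesis unfolding image_comp[symmetric] by (rule image_mono)
qed

lemma args_map_upt: "j < N \<Longrightarrow> args (map a [0..<N]) j = a j"
proof -
  have "j < length cs \<Longrightarrow> args cs j = cs ! j" for cs :: "('a, 'b) con list"
    by (induction cs arbitrary: j) (auto split: nat.split)
  then show "j < N \<Longrightarrow> ?thesis" by simp
qed

fun is_Wit :: "('i, 'm) con \<Rightarrow> bool" where
  "is_Wit (Wit k \<theta> q cs) = True"
| "is_Wit (Base n) = False"

fun con_args :: "('i, 'm) con \<Rightarrow> ('i, 'm) con set" where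
  "con_args (Wit k \<theta> q cs) = insert (Base 0) (set cs)"
| "con_args (Base n) = {}"

lemma size_arg: "d \<in> con_args c \<Longrightarrow> is_Wit d \<Longrightarrow> size d < size c"
  by (induction c) (auto simp: less_Suc_eq_le intro!: trans_le_add2 intro: size_list_estimation')

text \<open>The Henkin condition of a constant, as a formula in which each constant \<open>c\<close> occurs as the variable
  \<open>\<nu> c\<close>.\<close>

fun henkin :: "(('i, 'm) con \<Rightarrow> nat) \<Rightarrow> ('i, 'm::{finite,de_morgan_algebra}) con \<Rightarrow> ('i, 'm) fm" where
  "henkin \<nu> (Wit k \<theta> q cs) =
     (sub (Exists k (Gam q \<theta>)) (\<nu> \<circ> args cs)
       \<^bold>\<rightarrow> sub (Gam q \<theta>) ((\<nu> \<circ> args cs)(k := \<nu> (Wit k \<theta> q cs))))"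
| "henkin \<nu> (Base n) = Tv top"

lemma Fv_henkin: "Fv (henkin \<nu> c) \<subseteq> \<nu> ` insert c (con_args c)"
proof (cases c)
  case (Wit k \<theta> q cs)
  let ?\<rho> = "\<nu> \<circ> args cs" and ?K = "\<nu> ` insert c (con_args c)"
  have \<rho>: "?\<rho> ` A \<subseteq> ?K" for A
    using image_args[of \<nu> cs A] unfolding Wit by auto
  have "(?\<rho>(k := \<nu> c)) ` A \<subseteq> insert (\<nu> c) (?\<rho> ` A)" for A by auto
  also have "insert (\<nu> c) (?\<rho> ` A) \<subseteq> ?K" for A using \<rho> by simp
  finally have "Fv (sub (Gam q \<theta>) (?\<rho>(k := \<nu> c))) \<subseteq> ?K" unfolding Fv_sub .
  moreover have "Fv (sub (Exists k (Gam q \<theta>)) ?\<rho>) \<subseteq> ?K" unfolding Fv_sub by (rule \<rho>)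
  ultimately show ?thesis unfolding Wit henkin.simps Imp_def Fv.simps by (rule Un_least[rotated])
qed simp

context calculus
begin

lemma crisp_Imp: "crisp \<theta> \<Longrightarrow> crisp \<phi> \<Longrightarrow> crisp (\<theta> \<^bold>\<rightarrow> \<phi>)"
  by (auto simp: crisp_def Imp_def bot_top_simps)

lemma crisp_sub_Exists_Gam: "crisp (sub (Exists k (Gam q \<theta>)) \<tau>)"
  by (simp add: Let_def crisp_Exists crisp_Gam)

lemma crisp_henkin: "crisp (henkin \<nu> c)"
proof (cases c)
  case (Wit k \<theta> q cs)
  have "crisp (sub (Gam q \<theta>) \<tau>)" for \<tau> by (simp add: crisp_Gam)
  then show ?thesis
    unfolding Wit henkin.simps by (intro crisp_Imp crisp_sub_Exists_Gam)
qed (simp add: crisp_def)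

text \<open>A Henkin condition with a fresh witness \<open>x\<close> is harmless: from \<open>A \<rightarrow> B\<close> follows \<open>\<chi>\<close>, so by the \<open>\<exists>\<close>-rule it
  also follows from \<open>\<exists>x (A \<rightarrow> B)\<close>.  The latter is true, since \<open>A\<close> says the same as \<open>\<exists>x B\<close>.\<close>

lemma henkin_conservative:
  assumes x: "\<nu> (Wit k \<theta> q cs) \<notin> Fv \<chi>" "\<nu> (Wit k \<theta> q cs) \<notin> \<nu> ` insert (Base 0) (set cs)"
    and \<chi>: "derivable ar \<Sigma> (henkin \<nu> (Wit k \<theta> q cs) \<^bold>\<rightarrow> \<chi>)"
  shows "derivable ar \<Sigma> \<chi>"
proof (rule derivable_if_top_at_points)
  fix v assume v: "point v"
  let ?x = "\<nu> (Wit k \<theta> q cs)" and ?\<rho> = "\<nu> \<circ> args cs"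
  let ?\<eta> = "henkin \<nu> (Wit k \<theta> q cs)"
  let ?A = "sub (Exists k (Gam q \<theta>)) ?\<rho>" and ?B = "sub (Gam q \<theta>) (?\<rho>(k := ?x))"
  have \<eta>: "?\<eta> = Disj (Neg ?A) ?B" by (simp add: Imp_def)
  have "?x \<notin> ?\<rho> ` (Fv (Gam q \<theta>) - {k})" using x(2) image_args[of \<nu> cs] by blast
  then have A: "?A \<simeq> Exists ?x ?B" by (rule sub_Exists)
  have "?\<eta> \<preceq> Gam top \<chi>"
    unfolding sem_le_def
  proof (intro allI impI)
    fix w assume w: "point w"
    have "tval ?\<eta> w = top \<longrightarrow> tval \<chi> w = top"
      using point_top[OF w \<chi>] crisp_henkin w
      by (subst (asm) tval_Imp_eq_top) (simp_all only: crisp_def)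
    then show "tval ?\<eta> w \<le> tval (Gam top \<chi>) w"
      by (rule_tac crispE[OF crisp_henkin w, of \<nu> "Wit k \<theta> q cs"]) simp_all
  qed
  then have 1: "Exists ?x ?\<eta> \<preceq> Gam top \<chi>" by (rule Exists_least) (use x(1) in simp)
  have "?B \<preceq> ?\<eta>" unfolding \<eta> by (simp add: sem_le_def)
  then have "Exists ?x ?B \<preceq> Exists ?x ?\<eta>" by (rule Exists_mono)
  with A have 2: "?A \<preceq> Exists ?x ?\<eta>" by (rule sem_eq_le_trans)
  have "Neg ?A \<preceq> ?\<eta>" unfolding \<eta> by (simp add: sem_le_def)
  then have 3: "Neg ?A \<preceq> Exists ?x ?\<eta>" using Exists_increasing by (rule sem_le_trans)
  have 12: "tval ?A v \<le> tval (Gam top \<chi>) v"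
    using sem_le_trans[OF 2 1] v by (simp only: sem_le_def)
  have 13: "- tval ?A v \<le> tval (Gam top \<chi>) v"
    using sem_le_trans[OF 3 1] v by (simp only: sem_le_def tval.simps(4))
  have "tval (Gam top \<chi>) v = top"
    using 12 13 by (rule_tac crispE[OF crisp_sub_Exists_Gam v, of k q \<theta> ?\<rho>])
      (simp_all only: bot_top_simps top_unique)
  then show "tval \<chi> v = top" by (simp add: bot_top_simps split: if_split_asm)
qed

text \<open>The conditions are eliminated by decreasing size of their constants.  At each stage the witness is
  fresh: it is not an argument of a remaining constant, because arguments are smaller.  The
  induction therefore adds a constant of least size, whose condition joins the formula \<open>\<chi>\<close> that the
  induction hypothesis is applied to.\<close>

lemma henkin_point:
  assumes "finite D" "inj_on \<nu> K"
    and "\<And>c. c \<in> D \<Longrightarrow> is_Wit c \<and> insert c (con_args c) \<subseteq> K"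
    and "\<not> derivable ar \<Sigma> \<chi>" "Fv \<chi> \<inter> \<nu> ` D = {}"
  shows "\<exists>v. point v \<and> tval \<chi> v \<noteq> top \<and> (\<forall>c\<in>D. tval (henkin \<nu> c) v = top)"
  using assms(1,3,4,5)
proof (induction D arbitrary: \<chi> rule: finite_ranking_induct[where f = "\<lambda>c. - int (size c)"])
  case empty
  then show ?case using derivable_if_top_at_points[of \<chi>] by auto
next
  case (insert c D)
  show ?case
  proof (cases "c \<in> D")
    case True
    then show ?thesis using insert by (simp add: insert_absorb)
  next
    case False
    have c: "is_Wit c" "insert c (con_args c) \<subseteq> K" using insert.prems(1)[of c] by auto
    then obtain k \<theta> q cs where Wit: "c = Wit k \<theta> q cs" by (cases c) auto
    have args_other: "\<nu> d \<notin> \<nu> ` con_args c" if "d \<in> insert c D" for d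
    proof
      assume "\<nu> d \<in> \<nu> ` con_args c"
      then obtain e where e: "e \<in> con_args c" "\<nu> d = \<nu> e" by auto
      have d: "is_Wit d" "d \<in> K" using insert.prems(1)[OF that] by auto
      then have "d = e" using assms(2) c(2) e by (auto dest: inj_onD)
      then have "size d < size c" using size_arg[OF e(1)] d(1) by simp
      then show False using insert.hyps(2)[of d] that by auto
    qed
    have c_other: "\<nu> d \<noteq> \<nu> c" if "d \<in> D" for d
    proof
      assume "\<nu> d = \<nu> c"
      moreover have "d \<in> K" using insert.prems(1)[of d] that by auto
      ultimately have "d = c" using assms(2) c(2) by (auto dest: inj_onD)
      then show False using that False by simp
    qed
    let ?\<chi> = "henkin \<nu> c \<^bold>\<rightarrow> \<chi>"
    have "\<not> derivable ar \<Sigma> ?\<chi>"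
      using henkin_conservative[of \<nu> k \<theta> q cs \<chi>] insert.prems(2,3) args_other[of c]
      unfolding Wit by auto
    moreover have "Fv ?\<chi> \<inter> \<nu> ` D = {}"
      using insert.prems(3) Fv_henkin[of \<nu> c] args_other c_other by (fastforce simp: Imp_def)
    ultimately obtain v where v: "point v" "tval ?\<chi> v \<noteq> top" "\<forall>c\<in>D. tval (henkin \<nu> c) v = top"
      using insert.IH[of ?\<chi>] insert.prems(1) by auto
    have "tval (henkin \<nu> c) v = top" "tval \<chi> v \<noteq> top"
      using v(2) tval_Imp_eq_top[of "henkin \<nu> c" v \<chi>] crisp_henkin v(1) by (auto simp: crisp_def)
    then show ?thesis using v by auto
  qed
qed

end

section \<open>A limit of Henkin points\<close>

text \<open>Base constants receive the variable of their index, so that substituting the names of the base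
  constants into a formula does not change it.\<close>

lemma ex_naming:
  fixes K :: "('i, 'm) con set"
  assumes "finite K"
  shows "\<exists>\<nu>. (\<forall>j. \<nu> (Base j) = j) \<and> inj_on \<nu> K"
proof -
  obtain f :: "('i, 'm) con \<Rightarrow> nat" where f: "inj_on f K"
    using finite_imp_inj_to_nat_seg[OF assms] by auto
  have "finite (Base -` K)" using assms by (rule finite_vimageI) (simp add: inj_def)
  then obtain N where N: "\<And>j. Base j \<in> K \<Longrightarrow> j < N"
    unfolding finite_nat_set_iff_bounded by auto
  define \<nu> where "\<nu> c = (case c of Base j \<Rightarrow> j | Wit k \<theta> q cs \<Rightarrow> N + f c)" for c
  have "c = d" if "c \<in> K" "d \<in> K" "\<nu> c = \<nu> d" for c d
    using that N f by (cases c; cases d) (auto simp: \<nu>_def dest: inj_onD)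
  then have "inj_on \<nu> K" by (intro inj_onI)
  moreover have "\<forall>j. \<nu> (Base j) = j" by (simp add: \<nu>_def)
  ultimately show ?thesis by auto
qed

lemma finite_con_args: "finite (con_args c)"
  by (cases c) auto

context calculus
begin

lemma ex_henkin_point:
  assumes "\<not> derivable ar \<Sigma> \<phi>" "finite D"
  shows "\<exists>v \<nu>. point v \<and> tval (sub \<phi> (\<nu> \<circ> Base)) v \<noteq> top
    \<and> (\<forall>c\<in>D. tval (henkin \<nu> c) v = top)"
proof -
  let ?D = "{c \<in> D. is_Wit c}"
  define K where "K = ?D \<union> (\<Union>c\<in>?D. con_args c) \<union> Base ` Fv \<phi>"
  have "finite K" using assms(2) unfolding K_def by (simp add: finite_con_args finite_Fv)
  then obtain \<nu> where \<nu>: "\<And>j. \<nu> (Base j) = j" "inj_on \<nu> K" using ex_naming by blast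
  have \<chi>: "\<not> derivable ar \<Sigma> (sub \<phi> (\<nu> \<circ> Base))"
  proof -
    have "\<nu> \<circ> Base = id" using \<nu>(1) by auto
    then show ?thesis using assms(1) derivable_of_sem_eq[OF _ sub_id] by metis
  qed
  have Fv: "Fv (sub \<phi> (\<nu> \<circ> Base)) \<inter> \<nu> ` ?D = {}"
  proof (rule ccontr)
    assume "\<not> ?thesis"
    then obtain j d where jd: "j \<in> Fv \<phi>" "d \<in> ?D" "\<nu> (Base j) = \<nu> d"
      unfolding Fv_sub by auto
    then have "Base j = d" using \<nu>(2) by (intro inj_onD[of \<nu> K]) (auto simp: K_def)
    then show False using jd(2) by auto
  qed
  have "\<exists>v. point v \<and> tval (sub \<phi> (\<nu> \<circ> Base)) v \<noteq> top \<and> (\<forall>c\<in>?D. tval (henkin \<nu> c) v = top)"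
  proof (rule henkin_point[OF _ \<nu>(2) _ \<chi> Fv])
    show "finite ?D" using assms(2) by simp
    show "is_Wit c \<and> insert c (con_args c) \<subseteq> K" if "c \<in> ?D" for c
      using that unfolding K_def by blast
  qed
  then obtain v where v: "point v" "tval (sub \<phi> (\<nu> \<circ> Base)) v \<noteq> top"
      "\<forall>c\<in>?D. tval (henkin \<nu> c) v = top"
    by (elim exE conjE)
  have "tval (henkin \<nu> c) v = top" if "c \<in> D" for c
    using v(3) that by (cases c) auto
  then show ?thesis using v by (intro exI[of _ v] exI[of _ \<nu>]) simp
qed

end

text \<open>A value \<open>w \<theta> a\<close> for every formula with constants, such that any finite part of \<open>w\<close> comes from a
  point at which \<open>\<phi>\<close> is not true and at which any finite number of Henkin conditions hold.\<close>

locale henkin_limit = calculus ar \<Sigma>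
  for ar :: "'i \<Rightarrow> nat" and \<Sigma> :: "('i, 'm::{finite,de_morgan_algebra}) fm set" +
  fixes \<phi> :: "('i, 'm) fm" and w :: "('i, 'm) fm \<Rightarrow> (nat \<Rightarrow> ('i, 'm) con) \<Rightarrow> 'm"
  assumes approx: "finite X \<Longrightarrow> finite D \<Longrightarrow>
    \<exists>v \<nu>. point v \<and> tval (sub \<phi> (\<nu> \<circ> Base)) v \<noteq> top \<and>
      (\<forall>c\<in>D. tval (henkin \<nu> c) v = top) \<and> (\<forall>(\<theta>, a)\<in>X. w \<theta> a = tval (sub \<theta> (\<nu> \<circ> a)) v)"

lemma (in calculus) ex_henkin_limit:
  assumes "\<not> derivable ar \<Sigma> \<phi>"
  shows "\<exists>w. henkin_limit ar \<Sigma> \<phi> w"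
proof -
  define good where "good D p \<longleftrightarrow> (case p of (v, \<nu>) \<Rightarrow> point v \<and>
      tval (sub \<phi> (\<nu> \<circ> Base)) v \<noteq> top \<and> (\<forall>c\<in>D. tval (henkin \<nu> c) v = top))" for D p
  define g where "g D = (SOME p. good D p)" for D
  have good: "good D (g D)" if "finite D" for D
  proof -
    have "\<exists>p. good D p" using ex_henkin_point[OF assms that] unfolding good_def by simp
    then show ?thesis unfolding g_def by (rule someI_ex)
  qed
  define W where "W D = (\<lambda>(\<theta>, a). tval (sub \<theta> (snd (g D) \<circ> a)) (fst (g D)))" for D
  obtain w where "\<forall>X D. finite X \<longrightarrow> finite D \<longrightarrow>
      (\<exists>E. finite E \<and> D \<subseteq> E \<and> (\<forall>x\<in>X. w x = W E x))"
    using limit_along_finite_sets[of W] ..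
  note w = this[rule_format]
  have "henkin_limit ar \<Sigma> \<phi> (\<lambda>\<theta> a. w (\<theta>, a))"
  proof
    fix X :: "(('i, 'm) fm \<times> (nat \<Rightarrow> ('i, 'm) con)) set" and D :: "('i, 'm) con set"
    assume "finite X" "finite D"
    then obtain E where E: "finite E" "D \<subseteq> E" "\<forall>x\<in>X. w x = W E x" using w by meson
    obtain v \<nu> where g: "g E = (v, \<nu>)" by fastforce
    have "good E (v, \<nu>)" using good[OF E(1)] g by simp
    moreover have "\<forall>(\<theta>, a)\<in>X. w (\<theta>, a) = tval (sub \<theta> (\<nu> \<circ> a)) v"
      using E(3) g by (auto simp: W_def)
    ultimately show "\<exists>v \<nu>. point v \<and> tval (sub \<phi> (\<nu> \<circ> Base)) v \<noteq> top \<and>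
      (\<forall>c\<in>D. tval (henkin \<nu> c) v = top) \<and> (\<forall>(\<theta>, a)\<in>X. w (\<theta>, a) = tval (sub \<theta> (\<nu> \<circ> a)) v)"
      using E(2) unfolding good_def by (intro exI[of _ v] exI[of _ \<nu>]) auto
  qed
  then show ?thesis by (intro exI[of _ "\<lambda>\<theta> a. w (\<theta>, a)"])
qed

context henkin_limit
begin

lemma approx_value:
  assumes "finite X"
  obtains v \<nu> where "point v" "tval (sub \<phi> (\<nu> \<circ> Base)) v \<noteq> top"
    "\<And>\<theta> a. (\<theta>, a) \<in> X \<Longrightarrow> w \<theta> a = tval (sub \<theta> (\<nu> \<circ> a)) v"
proof -
  obtain v \<nu> where *: "point v \<and> tval (sub \<phi> (\<nu> \<circ> Base)) v \<noteq> top \<and>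
      (\<forall>c\<in>{}. tval (henkin \<nu> c) v = top) \<and> (\<forall>(\<theta>, a)\<in>X. w \<theta> a = tval (sub \<theta> (\<nu> \<circ> a)) v)"
    using approx[OF assms finite.emptyI] by (elim exE)
  have "w \<theta> a = tval (sub \<theta> (\<nu> \<circ> a)) v" if "(\<theta>, a) \<in> X" for \<theta> a
    using * that by auto
  then show thesis using * by (intro that[of v \<nu>]) simp_all
qed

text \<open>Here and below, a relation between finitely many values of \<open>w\<close> is read off from a point that agrees
  with \<open>w\<close> on them.\<close>

lemma w_connectives:
  "w (Tv p) a = p"
  "w (Neg \<theta>) a = - w \<theta> a"
  "w (Conj \<theta> \<psi>) a = inf (w \<theta> a) (w \<psi> a)"
  "w (Disj \<theta> \<psi>) a = sup (w \<theta> a) (w \<psi> a)"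
  "w (Gam p \<theta>) a = (if w \<theta> a = p then top else bot)"
  by (rule approx_value[of "{(Tv p, a), (Neg \<theta>, a), (Conj \<theta> \<psi>, a), (Disj \<theta> \<psi>, a), (Gam p \<theta>, a),
    (\<theta>, a), (\<psi>, a)}"]; simp)+

lemma w_theory: "\<sigma> \<in> \<Sigma> \<Longrightarrow> w \<sigma> a = top"
  by (rule approx_value[of "{(\<sigma>, a)}"]) (auto intro: point_top derivable_sub derivable.hyp)

lemma w_target: "w \<phi> Base \<noteq> top"
  by (rule approx_value[of "{(\<phi>, Base)}"]) auto

lemma w_le_Exists: "w \<theta> (a(k := c)) \<le> w (Exists k \<theta>) a"
proof (rule approx_value[of "{(\<theta>, a(k := c)), (Exists k \<theta>, a)}"])
  fix v \<nu> assume v: "point v"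
    and w: "\<And>\<theta>' a'. (\<theta>', a') \<in> {(\<theta>, a(k := c)), (Exists k \<theta>, a)} \<Longrightarrow> w \<theta>' a' = tval (sub \<theta>' (\<nu> \<circ> a')) v"
  have "\<nu> \<circ> a(k := c) = (\<nu> \<circ> a)(k := \<nu> c)" by auto
  then show ?thesis
    using tval_sub_le_Exists[OF v, of \<theta> "\<nu> \<circ> a" k "\<nu> c"] w[of \<theta>] w[of "Exists k \<theta>"]
    by (simp del: sub.simps)
qed simp

text \<open>The point is chosen to satisfy the Henkin conditions of the witnesses for all values \<open>q\<close>, of which
  there are finitely many.  Every value that \<open>\<theta>\<close> attains at the point is then attained at a constant,
  and \<open>\<exists>v\<^sub>k \<theta>\<close> has the supremum of the attained values.\<close>

lemma w_Exists: "w (Exists k \<theta>) a = Sup_fin (range (\<lambda>c. w \<theta> (a(k := c))))"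
proof (rule order_antisym)
  obtain N where N: "\<And>j. j \<in> Fv \<theta> \<Longrightarrow> j < N"
    using finite_Fv[of \<theta>] unfolding finite_nat_set_iff_bounded by auto
  let ?c = "\<lambda>q. Wit k \<theta> q (map a [0..<N])"
  let ?X = "insert (Exists k \<theta>, a) (range (\<lambda>q. (\<theta>, a(k := ?c q))))"
  have X: "finite ?X" by simp
  obtain v \<nu> where *: "point v \<and> tval (sub \<phi> (\<nu> \<circ> Base)) v \<noteq> top \<and>
      (\<forall>c\<in>range ?c. tval (henkin \<nu> c) v = top) \<and> (\<forall>(\<theta>, a)\<in>?X. w \<theta> a = tval (sub \<theta> (\<nu> \<circ> a)) v)"
    using approx[of ?X "range ?c", OF X finite_imageI[OF finite]] by (elim exE)
  have v: "point v" and hk: "tval (henkin \<nu> (?c q)) v = top" for q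
    using * by (elim conjE; blast)+
  have "\<forall>(\<theta>, a)\<in>?X. w \<theta> a = tval (sub \<theta> (\<nu> \<circ> a)) v" using * by (elim conjE)
  then have w: "w (Exists k \<theta>) a = tval (sub (Exists k \<theta>) (\<nu> \<circ> a)) v"
      "w \<theta> (a(k := ?c q)) = tval (sub \<theta> (\<nu> \<circ> a(k := ?c q))) v" for q
    by (simp_all del: sub.simps)
  define n where "n = fresh ((\<nu> \<circ> a) ` (Fv \<theta> - {k}))"
  let ?\<psi> = "sub \<theta> ((\<nu> \<circ> a)(k := n))"
  let ?B = "{q. tval (Exists n (Gam q ?\<psi>)) v = top}"
  have "?B \<subseteq> range (\<lambda>c. w \<theta> (a(k := c)))"
  proof
    fix q assume q: "q \<in> ?B"
    have same: "(\<nu> \<circ> args (map a [0..<N])) j = (\<nu> \<circ> a) j" if "j \<in> Fv \<theta>" for j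
      using N[OF that] by (simp add: args_map_upt)
    have "sub (Exists k (Gam q \<theta>)) (\<nu> \<circ> args (map a [0..<N])) = sub (Exists k (Gam q \<theta>)) (\<nu> \<circ> a)"
      by (rule sub_cong) (use same in auto)
    also have "\<dots> = Exists n (Gam q ?\<psi>)" by (simp add: n_def Let_def)
    finally have "tval (sub (Exists k (Gam q \<theta>)) (\<nu> \<circ> args (map a [0..<N]))) v = top"
      using q by (simp only: mem_Collect_eq)
    then have "tval (sub (Gam q \<theta>) ((\<nu> \<circ> args (map a [0..<N]))(k := \<nu> (?c q)))) v = top"
      using hk[of q] unfolding henkin.simps by (subst (asm) tval_Imp_eq_top) simp_all
    also have "sub (Gam q \<theta>) ((\<nu> \<circ> args (map a [0..<N]))(k := \<nu> (?c q)))
        = sub (Gam q \<theta>) (\<nu> \<circ> a(k := ?c q))"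
      by (rule sub_cong) (use same in auto)
    finally have "tval (sub \<theta> (\<nu> \<circ> a(k := ?c q))) v = q"
      by (simp add: bot_top_simps split: if_split_asm)
    then have "w \<theta> (a(k := ?c q)) = q" using w(2)[of q] by simp
    then show "q \<in> range (\<lambda>c. w \<theta> (a(k := c)))" by (rule range_eqI[OF sym])
  qed
  then have "Sup_fin ?B \<le> Sup_fin (range (\<lambda>c. w \<theta> (a(k := c))))"
    using tval_Exists(1)[OF v] by (intro Sup_fin.subset_imp) auto
  moreover have "w (Exists k \<theta>) a = tval (Exists n ?\<psi>) v"
    using w(1) by (simp add: n_def Let_def)
  ultimately show "w (Exists k \<theta>) a \<le> Sup_fin (range (\<lambda>c. w \<theta> (a(k := c))))"
    using tval_Exists(2)[OF v, of n ?\<psi>] by simp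
  show "Sup_fin (range (\<lambda>c. w \<theta> (a(k := c)))) \<le> w (Exists k \<theta>) a"
    by (rule Sup_fin.boundedI) (auto intro: w_le_Exists)
qed

definition pair :: "('i, 'm) con \<Rightarrow> ('i, 'm) con \<Rightarrow> nat \<Rightarrow> ('i, 'm) con" where
  "pair c d j = (if j = 0 then c else d)"

text \<open>Constants are compared by evaluating the fixed formula \<open>v\<^sub>0 \<approx> v\<^sub>1\<close> at them.\<close>

definition eqc :: "('i, 'm) con \<Rightarrow> ('i, 'm) con \<Rightarrow> bool"  (infix "\<approx>" 50) where
  "c \<approx> d \<longleftrightarrow> w (Eql 0 1) (pair c d) = top"

lemma pair_simps [simp]: "pair c d 0 = c" "pair c d (Suc j) = d"
  by (simp_all add: pair_def)

lemma eqc_refl: "c \<approx> c"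
  by (rule approx_value[of "{(Eql 0 1, pair c c)}"]) (auto simp: eqc_def Eql_refl[unfolded tval.simps])

lemma eqc_sym: "c \<approx> d \<Longrightarrow> d \<approx> c"
proof (rule approx_value[of "{(Eql 0 1, pair c d), (Eql 0 1, pair d c)}"])
  fix v \<nu> assume "c \<approx> d" and v: "point v" and w: "\<And>\<theta>' a'. (\<theta>', a') \<in>
    {(Eql 0 1, pair c d), (Eql 0 1, pair d c)} \<Longrightarrow> w \<theta>' a' = tval (sub \<theta>' (\<nu> \<circ> a')) v"
  then have "v (Eql (\<nu> c) (\<nu> d)) = top" by (simp add: eqc_def)
  then have "v (Eql (\<nu> d) (\<nu> c)) = top"
    using Eql_sym[of "\<nu> c" "\<nu> d"] v unfolding sem_eq_def by auto
  then show "d \<approx> c" using w by (simp add: eqc_def)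
qed simp

lemma eqc_trans: "c \<approx> d \<Longrightarrow> d \<approx> e \<Longrightarrow> c \<approx> e"
proof (rule approx_value[of "{(Eql 0 1, pair c d), (Eql 0 1, pair d e), (Eql 0 1, pair c e)}"])
  fix v \<nu> assume "c \<approx> d" "d \<approx> e" and v: "point v" and w: "\<And>\<theta>' a'. (\<theta>', a') \<in>
    {(Eql 0 1, pair c d), (Eql 0 1, pair d e), (Eql 0 1, pair c e)} \<Longrightarrow>
      w \<theta>' a' = tval (sub \<theta>' (\<nu> \<circ> a')) v"
  then have "v (Eql (\<nu> c) (\<nu> d)) = top" "v (Eql (\<nu> d) (\<nu> e)) = top" by (simp_all add: eqc_def)
  then have "v (Eql (\<nu> c) (\<nu> e)) = top"
    using Eql_trans[of "\<nu> c" "\<nu> d" "\<nu> e"] v unfolding sem_le_def by (auto simp: top_unique)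
  then show "c \<approx> e" using w by (simp add: eqc_def)
qed simp

lemma w_Eql: "w (Eql j k) a = (if a j \<approx> a k then top else bot)"
proof (rule approx_value[of "{(Eql j k, a), (Eql 0 1, pair (a j) (a k))}"])
  fix v \<nu> assume v: "point v" and w: "\<And>\<theta>' a'. (\<theta>', a') \<in>
    {(Eql j k, a), (Eql 0 1, pair (a j) (a k))} \<Longrightarrow> w \<theta>' a' = tval (sub \<theta>' (\<nu> \<circ> a')) v"
  have "w (Eql j k) a = v (Eql (\<nu> (a j)) (\<nu> (a k)))" "a j \<approx> a k \<longleftrightarrow> v (Eql (\<nu> (a j)) (\<nu> (a k))) = top"
    using w by (simp_all add: eqc_def)
  then show ?thesis using crispD[OF crisp_Eql v, of "\<nu> (a j)" "\<nu> (a k)"] by auto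
qed simp

text \<open>Both atoms are instances of one atom in the variables \<open>0, 1, \<dots>\<close>, so the claim is an instance of the
  congruence property of equality.  It makes the relations of the term model disjoint for
  different values.\<close>

lemma w_Rel_cong:
  assumes "length ks = length ls" "\<And>j. j < length ks \<Longrightarrow> a (ks ! j) \<approx> b (ls ! j)"
  shows "w (Rel i ks) a = w (Rel i ls) b"
proof (rule approx_value[of "insert (Rel i ks, a) (insert (Rel i ls, b)
    ((\<lambda>j. (Eql 0 1, pair (a (ks ! j)) (b (ls ! j)))) ` {..<length ks}))"])
  fix v \<nu> assume v: "point v" and w: "\<And>\<theta>' a'. (\<theta>', a') \<in> insert (Rel i ks, a) (insert (Rel i ls, b)
    ((\<lambda>j. (Eql 0 1, pair (a (ks ! j)) (b (ls ! j)))) ` {..<length ks})) \<Longrightarrow>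
      w \<theta>' a' = tval (sub \<theta>' (\<nu> \<circ> a')) v"
  let ?xs = "map (\<nu> \<circ> a) ks" and ?ys = "map (\<nu> \<circ> b) ls"
  have "v (Eql (?xs ! j) (?ys ! j)) = top" if "j < length ks" for j
    using w[of "Eql 0 1" "pair (a (ks ! j)) (b (ls ! j))"] assms(2)[OF that] that assms(1)
    by (auto simp: eqc_def)
  then have "tval (sub (Rel i [0..<length ks]) ((!) ?xs)) v = tval (sub (Rel i [0..<length ks]) ((!) ?ys)) v"
    by (intro tval_sub_Eql[OF v]) auto
  then have "v (Rel i ?xs) = v (Rel i ?ys)"
    using map_nth[of ?xs] map_nth[of ?ys] assms(1) by simp
  then show ?thesis using w by simp
qed simp

end

section \<open>The term model\<close>

lemma den_subset_seqs: "den U P \<theta> q \<subseteq> seqs U"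
proof (induction \<theta> arbitrary: q)
  case (Exists k \<theta>)
  have "s \<in> seqs U" if "A \<noteq> {}" "\<forall>q\<in>A. s \<in> cyl U k (den U P \<theta> q)" for A s
    using that by (auto simp: cyl_def)
  then show ?case by auto
qed (auto split: if_split_asm)

locale term_model = henkin_limit ar \<Sigma> \<phi> w
  for ar :: "'i \<Rightarrow> nat" and \<Sigma> :: "('i, 'm::{finite,de_morgan_algebra}) fm set" and \<phi> w +
  fixes h :: "('i, 'm) con \<Rightarrow> 'u"
  assumes inj_h: "inj h"
begin

text \<open>The universe consists of (codes of) representatives of the classes of equal constants.\<close>

definition elt :: "('i, 'm) con \<Rightarrow> 'u" where
  "elt c = h (SOME d. c \<approx> d)"

lemma elt_eq_iff: "elt c = elt d \<longleftrightarrow> c \<approx> d"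
proof
  have rep: "c \<approx> (SOME d. c \<approx> d)" for c using eqc_refl by (rule someI)
  assume "elt c = elt d"
  then have "(SOME e. c \<approx> e) = (SOME e. d \<approx> e)" using inj_h by (simp add: elt_def inj_def)
  then show "c \<approx> d" using rep[of c] rep[of d] eqc_sym eqc_trans by metis
next
  assume "c \<approx> d"
  then have "c \<approx> e \<longleftrightarrow> d \<approx> e" for e using eqc_sym eqc_trans by metis
  then show "elt c = elt d" by (simp add: elt_def)
qed

definition U :: "'u set" where "U = range elt"

definition P :: "'i \<Rightarrow> 'm \<Rightarrow> 'u list set" where
  "P i q = {map (elt \<circ> a) ks | a ks. length ks = ar i \<and> w (Rel i ks) a = q}"

lemma map_elt_in_P: "length ks = ar i \<Longrightarrow> map (elt \<circ> a) ks \<in> P i q \<longleftrightarrow> w (Rel i ks) a = q"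
proof
  assume ks: "length ks = ar i" and "map (elt \<circ> a) ks \<in> P i q"
  then obtain b ls where b: "map (elt \<circ> a) ks = map (elt \<circ> b) ls" "length ls = ar i" "w (Rel i ls) b = q"
    unfolding P_def by auto
  have "a (ks ! j) \<approx> b (ls ! j)" if "j < length ks" for j
    using arg_cong[OF b(1), of "\<lambda>xs. xs ! j"] that ks b(2) by (simp add: elt_eq_iff)
  then show "w (Rel i ks) a = q" using w_Rel_cong[of ks ls a b i] ks b by simp
qed (auto simp: P_def)

lemma is_structure_U_P: "is_structure ar U P"
proof -
  have "P i p \<inter> P i q = {}" if "p \<noteq> q" for i p q
  proof -
    have "xs \<notin> P i q" if xs: "xs \<in> P i p" for xs
    proof -
      obtain a ks where "xs = map (elt \<circ> a) ks" "length ks = ar i" "w (Rel i ks) a = p"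
        using xs unfolding P_def by auto
      then show ?thesis using map_elt_in_P[of ks i a q] \<open>p \<noteq> q\<close> by simp
    qed
    then show ?thesis by blast
  qed
  moreover have "(\<Union>q. P i q) = tuples U (ar i)" for i
  proof
    show "(\<Union>q. P i q) \<subseteq> tuples U (ar i)" by (auto simp: P_def tuples_def U_def)
    show "tuples U (ar i) \<subseteq> (\<Union>q. P i q)"
    proof
      fix xs assume "xs \<in> tuples U (ar i)"
      then have xs: "length xs = ar i" "set xs \<subseteq> range elt" by (auto simp: tuples_def U_def)
      then obtain cs where cs: "xs = map elt cs" by (metis ex_map_conv subsetD rangeE)
      then have "xs = map (elt \<circ> (!) cs) [0..<ar i]"
        using xs(1) map_nth[of cs] by (simp flip: map_map)
      then show "xs \<in> (\<Union>q. P i q)" using map_elt_in_P[of "[0..<ar i]" i "(!) cs"] by simp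
    qed
  qed
  ultimately show ?thesis by (auto simp: is_structure_def U_def)
qed

lemma seqs_U: "s \<in> seqs U \<longleftrightarrow> (\<exists>a. s = elt \<circ> a)"
proof
  assume "s \<in> seqs U"
  then have "\<forall>k. \<exists>c. s k = elt c" by (auto simp: seqs_def U_def)
  then show "\<exists>a. s = elt \<circ> a" by (auto simp: fun_eq_iff dest: choice)
qed (auto simp: seqs_def U_def)

lemma elt_in_seqs [simp]: "(\<lambda>j. elt (a j)) \<in> seqs U"
  by (simp add: seqs_def U_def)

text \<open>Every sequence over the universe has the form \<open>elt \<circ> a\<close>, and along such sequences the semantic
  clauses are those that \<open>w\<close> obeys.\<close>

lemma truth: "wf_fm ar \<theta> \<Longrightarrow> elt \<circ> a \<in> den U P \<theta> q \<longleftrightarrow> w \<theta> a = q"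
proof (induction \<theta> arbitrary: a q)
  case (Rel i ks)
  then show ?case using map_elt_in_P[of ks i a q] seqs_U by (auto simp: comp_def)
next
  case (Eql j k)
  show ?case by (auto simp: w_Eql elt_eq_iff bot_top_simps)
next
  case (Tv p)
  show ?case by (auto simp: w_connectives)
next
  case (Neg \<theta>)
  then show ?case by (auto simp: w_connectives uminus_uminus)
next
  case (Conj \<theta>1 \<theta>2)
  then show ?case by (auto simp: w_connectives)
next
  case (Disj \<theta>1 \<theta>2)
  then show ?case by (auto simp: w_connectives)
next
  case (Gam p \<theta>)
  show ?case using Gam by (auto simp: w_connectives bot_top_simps)
next
  case (Exists k \<theta>)
  let ?B = "range (\<lambda>c. w \<theta> (a(k := c)))"
  have upd: "(elt \<circ> a)(k := elt c) = elt \<circ> a(k := c)" for c by auto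
  have "elt \<circ> a \<in> cyl U k (den U P \<theta> q) \<longleftrightarrow> q \<in> ?B" for q
  proof -
    have "(\<exists>x\<in>U. R x) \<longleftrightarrow> (\<exists>c. R (elt c))" for R by (auto simp: U_def)
    then have "elt \<circ> a \<in> cyl U k (den U P \<theta> q) \<longleftrightarrow> (\<exists>c. elt \<circ> a(k := c) \<in> den U P \<theta> q)"
      unfolding cyl_def mem_Collect_eq upd[symmetric] by (simp add: comp_def)
    also have "\<dots> \<longleftrightarrow> (\<exists>c. w \<theta> (a(k := c)) = q)"
      using Exists.IH Exists.prems by (simp only: wf_fm.simps)
    finally show ?thesis by (simp add: image_iff eq_commute)
  qed
  then have "elt \<circ> a \<in> (\<Inter>q\<in>A. cyl U k (den U P \<theta> q)) \<longleftrightarrow> A \<subseteq> ?B" for A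
    by (simp only: INT_iff subset_eq)
  then have "elt \<circ> a \<in> den U P (Exists k \<theta>) q \<longleftrightarrow>
      (\<exists>A. A \<noteq> {} \<and> Sup_fin A = q \<and> A \<subseteq> ?B) \<and> \<not> (\<exists>A. A \<noteq> {} \<and> Sup_fin A > q \<and> A \<subseteq> ?B)"
    unfolding den.simps Diff_iff UN_iff Bex_def mem_Collect_eq by (simp only: conj_assoc)
  also have "\<dots> \<longleftrightarrow> q = Sup_fin ?B" by (rule Sup_fin_subsets_iff) simp
  finally show ?case unfolding w_Exists by (simp only: eq_commute)
qed

lemma true_in_iff: "wf_fm ar \<theta> \<Longrightarrow> true_in U P \<theta> \<longleftrightarrow> (\<forall>a. w \<theta> a = top)"
proof -
  assume \<theta>: "wf_fm ar \<theta>"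
  have "den U P \<theta> top \<subseteq> seqs U" by (rule den_subset_seqs)
  then have "true_in U P \<theta> \<longleftrightarrow> (\<forall>s\<in>seqs U. s \<in> den U P \<theta> top)" unfolding true_in_def by blast
  also have "\<dots> \<longleftrightarrow> (\<forall>a. elt \<circ> a \<in> den U P \<theta> top)" using seqs_U by auto
  finally show ?thesis by (simp add: truth[OF \<theta>])
qed

end

section \<open>Completeness\<close>

lemma derivable_if_entails:
  fixes \<Sigma> :: "('i, 'm::{finite,de_morgan_algebra}) fm set" and g :: "('i, 'm) fm \<Rightarrow> 'u"
  assumes "inj g"
    and "\<Sigma> \<subseteq> formulas ar" "\<phi> \<in> formulas ar" "entails TYPE('u) ar \<Sigma> \<phi>"
  shows "derivable ar \<Sigma> \<phi>"
proof (rule ccontr)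
  assume "\<not> derivable ar \<Sigma> \<phi>"
  then obtain w where w: "henkin_limit ar \<Sigma> \<phi> w" using calculus.ex_henkin_limit by blast
  have "inj (g \<circ> con_code)" using assms(1) by (auto simp: inj_def dest: con_code_inject)
  with w interpret term_model ar \<Sigma> \<phi> w "g \<circ> con_code"
    by (simp add: term_model_def term_model_axioms_def)
  have "true_in U P \<sigma>" if "\<sigma> \<in> \<Sigma>" for \<sigma>
    using that assms(2) true_in_iff w_theory by (auto simp: formulas_def)
  then have "true_in U P \<phi>" using assms(4) is_structure_U_P unfolding entails_def by blast
  then show False using true_in_iff w_target assms(3) by (auto simp: formulas_def)
qed

text \<open>The disjuncts are two-valued, so the disjunction is too.\<close>

lemma den_disj_list_Gam:
  assumes "s \<in> seqs U"
  shows "s \<in> den U P (disj_list (map (\<lambda>p. Gam p \<phi>) ps)) q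
    \<longleftrightarrow> q = (if \<exists>p\<in>set ps. s \<in> den U P \<phi> p then top else bot)"
proof (induction ps arbitrary: q)
  case (Cons p ps)
  show ?case
  proof (cases ps)
    case Nil
    then show ?thesis using assms by (auto simp: bot_top_simps)
  next
    case (Cons p' ps')
    then have "disj_list (map (\<lambda>p. Gam p \<phi>) (p # ps))
        = Disj (Gam p \<phi>) (disj_list (map (\<lambda>p. Gam p \<phi>) ps))" by simp
    moreover have "s \<in> den U P (Gam p \<phi>) r \<longleftrightarrow> r = (if s \<in> den U P \<phi> p then top else bot)" for r
      using assms by (auto simp: bot_top_simps)
    ultimately show ?thesis using Cons.IH by (auto simp del: den.simps(8))
  qed
qed (use assms in auto)

lemma Q_true_in_iff: "Q_true_in Q U P \<phi> \<longleftrightarrow> true_in U P (Qfm Q \<phi>)"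
proof -
  have "s \<in> (\<Union>p\<in>Q. den U P \<phi> p) \<longleftrightarrow> s \<in> den U P (Qfm Q \<phi>) top" if "s \<in> seqs U" for s
    unfolding Qfm_def BigDisj_def den_disj_list_Gam[OF that]
    by (simp add: set_enum_set bot_top_simps)
  moreover have "(\<Union>p\<in>Q. den U P \<phi> p) \<subseteq> seqs U" "den U P (Qfm Q \<phi>) top \<subseteq> seqs U"
    using den_subset_seqs by blast+
  ultimately show ?thesis unfolding Q_true_in_def true_in_def by blast
qed

lemma Qfm_in_formulas: "\<phi> \<in> formulas ar \<Longrightarrow> Qfm Q \<phi> \<in> formulas ar"
proof -
  assume \<phi>: "\<phi> \<in> formulas ar"
  have "wf_fm ar (disj_list \<psi>s)" if "\<forall>\<psi>\<in>set \<psi>s. wf_fm ar \<psi>" for \<psi>s :: "('a, 'b) fm list"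
    using that by (induction \<psi>s rule: disj_list.induct) auto
  then show ?thesis using \<phi> by (simp add: formulas_def Qfm_def BigDisj_def)
qed

theorem theorem3p43:
  fixes ar :: "'i \<Rightarrow> nat"
    and Q :: "'m::{finite,de_morgan_algebra} set"
    and \<Sigma> :: "('i, 'm) fm set"
    and \<phi> :: "('i, 'm) fm"
  assumes universe_large: "\<exists>f :: ('i, 'm) fm \<Rightarrow> 'u. inj f"
    and "\<Sigma> \<subseteq> formulas ar"
    and "\<phi> \<in> formulas ar"
  shows "(entails TYPE('u) ar \<Sigma> \<phi> \<longrightarrow> proves ar \<Sigma> \<phi>) \<and>
         (Q_entails TYPE('u) ar Q \<Sigma> \<phi> \<longrightarrow> Q_proves ar Q \<Sigma> \<phi>)"
proof -
  obtain f :: "('i, 'm) fm \<Rightarrow> 'u" where f: "inj f" using universe_large by blast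
  have complete: "proves ar T \<theta>"
    if "entails TYPE('u) ar T \<theta>" "T \<subseteq> formulas ar" "\<theta> \<in> formulas ar" for T and \<theta> :: "('i, 'm) fm"
    using derivable_if_entails[OF f] proves_of_derivable that by blast
  have "Q_proves ar Q \<Sigma> \<phi>" if "Q_entails TYPE('u) ar Q \<Sigma> \<phi>"
  proof -
    have "entails TYPE('u) ar (Qfm Q ` \<Sigma>) (Qfm Q \<phi>)"
      using that unfolding entails_def Q_entails_def Q_true_in_iff by simp
    moreover have "Qfm Q ` \<Sigma> \<subseteq> formulas ar" "Qfm Q \<phi> \<in> formulas ar"
      using assms(2,3) Qfm_in_formulas by auto
    ultimately show ?thesis unfolding Q_proves_def by (rule complete)
  qed
  then show ?thesis using complete assms(2,3) by blast
qed

end
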